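(* For every $\xi\in(-1,0)$ and every $t>0$, the random variable $\mathbf{\Gamma}_t^{\,\xi}$ is self-decomposable, where $\mathbf{\Gamma}_t$ denotes a Gamma random variable with density $x\mapsto \frac{x^{t-1}e^{-x}}{\Gamma(t)}$ on $(0,\infty)$.
   Context: $\{\mathbf{\Gamma}_t,\ t\ge 0\}$ is the (standard) Gamma subordinator, so that for each $t>0$ the variable $\mathbf{\Gamma}_t$ has density $\frac{x^{t-1}e^{-x}}{\Gamma(t)}$ on $(0,\infty)$, with $\Gamma(\cdot)$ the Euler Gamma function. $\mathbf{\Gamma}_t^{\,\xi}$ is the power of order $\xi$ of this positive random variable. A real random variable $X$ is self-decomposable if for every $c\in(0,1)$ there exists a random variable $X_c$, independent of $X$, such that $X$ has the same distribution as $cX+X_c$. *)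

theory Defs
  imports "HOL-Probability.Probability"
begin

definition gamma_density :: "real \<Rightarrow> real \<Rightarrow> real" where
  "gamma_density t x = (if 0 < x then x powr (t - 1) * exp (- x) / Gamma t else 0)"

text \<open>
  Self-decomposability concerns only the law of \<open>X\<close>. The given space \<open>M\<close> need not be rich enough
  to carry a variable independent of \<open>X\<close>, so \<open>X\<close> is replaced by a copy \<open>Y\<close> with the same law on
  an auxiliary probability space \<open>N\<close>, on which \<open>Z\<close> plays the role of \<open>X\<^sub>c\<close>. Fixing the sample
  type of \<open>N\<close> to be the plane is no restriction: the joint law of a pair of real variables can be
  realised there by the two coordinate projections.
\<close>

definition (in prob_space) self_decomposable :: "('a \<Rightarrow> real) \<Rightarrow> bool" where
  "self_decomposable X \<longleftrightarrow>
     random_variable borel X \<and>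
     (\<forall>c. 0 < c \<and> c < 1 \<longrightarrow>
       (\<exists>(N :: (real \<times> real) measure) Y Z.
          prob_space N \<and>
          prob_space.indep_var N borel Y borel Z \<and>
          distr N borel Y = distr M borel X \<and>
          distr N borel (\<lambda>\<omega>. c * Y \<omega> + Z \<omega>) = distr M borel X))"

end

theory Submission
  imports Defs
begin

text \<open>
  Write \<open>a = - \<xi>\<close>, so \<open>0 < a < 1\<close>, and let \<open>L\<close> be the Laplace transform of \<open>X = G powr (- a)\<close>.
  Self-decomposability of \<open>X\<close> says that every quotient \<open>L x / L (c * x)\<close> with \<open>0 < c < 1\<close> is
  again a Laplace transform of a probability measure. Here this is derived from complete monotonicity
  of the quotient (\<open>self_decomposableI_cm\<close>): its values at the natural numbers are the moments of a
  law on the unit interval, by Hausdorff's theorem, and minus the logarithm of a variable with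
  that law is the required independent summand.

  The probabilistic reason for complete monotonicity is that \<open>X\<close> has the law of an exponential
  functional \<open>\<integral> exp (- \<eta>\<^sub>s) ds\<close> of a Levy process \<open>\<eta>\<close>, drifting to infinity, without positive jumps. Such a process
  passes upwards through the level \<open>- ln c\<close> continuously; splitting the integral at the passage time
  expresses \<open>X\<close> as \<open>X\<^sub>c + c X'\<close> with \<open>X'\<close> an independent copy of \<open>X\<close>. The proof below is an analytic
  version of this argument which uses no stochastic processes.

  First the Gamma variable is replaced by \<open>n\<close> times a Beta variable with parameters \<open>t\<close> and \<open>n + 1\<close>,
  whose kernel \<open>u powr (t - 1) * (1 - u / n) ^ n\<close> tends to the Gamma kernel; complete monotonicity
  survives pointwise limits. For the Beta variable the process is elementary: unit upward drift and
  finitely many types of exponentially distributed downward jumps, all with positive intensity. The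
  intensities come from the partial fraction expansion of a quotient of two Beta functions
  (\<open>partial_fractions_shift\<close>); they are positive exactly because zeros and poles of this rational
  function interlace, which is where \<open>a < 1\<close> enters (\<open>weight_nonneg\<close>).

  Let \<open>\<phi>\<close> be the transform of the (unnormalised) law of the inverse of \<open>W\<close>, the power \<open>a\<close> of the
  Beta variable, and let \<open>K\<close> be the jump measure. The recursion for the moments of \<open>W\<close> is the integral equation
  satisfied by \<open>\<phi>\<close>, tested on monomials; polynomial approximation gives the equation itself
  (\<open>generator_identity\<close>, \<open>\<phi>_equation\<close>). Divided by \<open>\<phi>\<close>, it says that
  \<open>g x = (\<integral>y. \<phi> (x * exp y) \<partial>K) / \<phi> x\<close> is a fixed point of a nonlinear operator \<open>jump_op\<close> which
  preserves complete monotonicity. This operator is a contraction in a suitable weighted sup norm, so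
  \<open>g\<close> is the limit of the iterates started at \<open>0\<close>, hence completely monotone
  (\<open>fixed_point_cm\<close>). Finally \<open>\<phi> x / \<phi> (c * x)\<close> is an explicit exponential expression in \<open>g\<close> which is
  completely monotone together with \<open>g\<close> (\<open>\<phi>_ratio_cm\<close>).
\<close>

section \<open>Completely monotone functions on the positive half-line\<close>

text \<open>
  Complete monotonicity up to order \<open>n\<close>, expressed through differences instead of derivatives: no
  smoothness has to be established, and closure under integrals and pointwise limits is immediate.
  A function is completely monotone if this holds for every \<open>n\<close>.
\<close>

primrec cm_upto :: "nat \<Rightarrow> (real \<Rightarrow> real) \<Rightarrow> bool" where
  "cm_upto 0 f \<longleftrightarrow> (\<forall>x>0. 0 \<le> f x)"
| "cm_upto (Suc n) f \<longleftrightarrow> (\<forall>x>0. 0 \<le> f x) \<and> (\<forall>a>0. cm_upto n (\<lambda>x. f x - f (x + a)))"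

lemma cm_upto_cong: "(\<And>x. x > 0 \<Longrightarrow> f x = g x) \<Longrightarrow> cm_upto n f = cm_upto n g"
proof (induction n arbitrary: f g)
  case (Suc n)
  have "cm_upto n (\<lambda>x. f x - f (x + a)) = cm_upto n (\<lambda>x. g x - g (x + a))" if "a > 0" for a
    using that by (intro Suc.IH) (simp add: Suc.prems)
  with Suc.prems show ?case by auto
qed auto

lemma cm_upto_nonneg: "cm_upto n f \<Longrightarrow> x > 0 \<Longrightarrow> 0 \<le> f x"
  by (cases n) auto

lemma cm_upto_Suc_D: "cm_upto (Suc n) f \<Longrightarrow> cm_upto n f"
proof (induction n arbitrary: f)
  case (Suc n)
  then show ?case by (metis cm_upto.simps(2))
qed auto

lemma cm_upto_add: "cm_upto n f \<Longrightarrow> cm_upto n g \<Longrightarrow> cm_upto n (\<lambda>x. f x + g x)"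
proof (induction n arbitrary: f g)
  case (Suc n)
  have "cm_upto n (\<lambda>x. (f x - f (x + a)) + (g x - g (x + a)))" if "a > 0" for a
    using Suc that by (intro Suc.IH) auto
  then have "cm_upto n (\<lambda>x. (f x + g x) - (f (x + a) + g (x + a)))" if "a > 0" for a
    using that by (simp only: add_diff_add)
  with Suc.prems show ?case by auto
qed auto

lemma cm_upto_scaleL: "c \<ge> 0 \<Longrightarrow> cm_upto n f \<Longrightarrow> cm_upto n (\<lambda>x. c * f x)"
proof (induction n arbitrary: f)
  case (Suc n)
  have "cm_upto n (\<lambda>x. c * (f x - f (x + a)))" if "a > 0" for a
    using Suc that by (intro Suc.IH) auto
  with Suc.prems show ?case by (simp add: right_diff_distrib)
qed auto

lemma cm_upto_shift: "a \<ge> 0 \<Longrightarrow> cm_upto n f \<Longrightarrow> cm_upto n (\<lambda>x. f (x + a))"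
proof (induction n arbitrary: f)
  case (Suc n)
  have "cm_upto n (\<lambda>x. f (x + a) - f (x + a + b))" if "b > 0" for b
    using Suc.IH[of "\<lambda>x. f x - f (x + b)"] Suc.prems that by auto
  with Suc.prems show ?case by (simp add: add_ac)
qed auto

text \<open>
  The Leibniz rule for differences: the difference of \<open>f * g\<close> is a sum of two products in each of which
  one factor is a difference.
\<close>

lemma cm_upto_mult: "cm_upto n f \<Longrightarrow> cm_upto n g \<Longrightarrow> cm_upto n (\<lambda>x. f x * g x)"
proof (induction n arbitrary: f g)
  case (Suc n)
  have "cm_upto n (\<lambda>x. f x * g x - f (x + a) * g (x + a))" if "a > 0" for a
  proof -
    have "cm_upto n (\<lambda>x. (f x - f (x + a)) * g x)"
      using Suc.prems that by (intro Suc.IH cm_upto_Suc_D[of n g]) auto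
    moreover have "cm_upto n (\<lambda>x. f (x + a) * (g x - g (x + a)))"
      using Suc.prems that cm_upto_shift[OF _ cm_upto_Suc_D, of a n f] by (intro Suc.IH) auto
    ultimately have "cm_upto n (\<lambda>x. (f x - f (x + a)) * g x + f (x + a) * (g x - g (x + a)))"
      by (rule cm_upto_add)
    then show ?thesis by (simp add: algebra_simps)
  qed
  with Suc.prems show ?case by auto
qed auto

lemma cm_upto_dilate: "b > 0 \<Longrightarrow> cm_upto n f \<Longrightarrow> cm_upto n (\<lambda>x. f (b * x))"
proof (induction n arbitrary: f)
  case (Suc n)
  have "cm_upto n (\<lambda>x. f (b * x) - f (b * (x + a)))" if "a > 0" for a
    using Suc.IH[of "\<lambda>x. f x - f (x + b * a)"] Suc.prems that by (simp add: distrib_left)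
  with Suc.prems show ?case by auto
qed auto

lemma cm_upto_lim:
  assumes "\<And>k::nat. cm_upto n (f k)" "\<And>x. x > 0 \<Longrightarrow> (\<lambda>k. f k x) \<longlonglongrightarrow> g x"
  shows "cm_upto n g"
  using assms
proof (induction n arbitrary: f g)
  case 0
  have "0 \<le> g x" if "x > 0" for x
    using 0(1) that by (intro LIMSEQ_le_const[OF 0(2)]) auto
  then show ?case by simp
next
  case (Suc n)
  have "cm_upto n (\<lambda>x. g x - g (x + a))" if "a > 0" for a
  proof (rule Suc.IH)
    show "cm_upto n (\<lambda>x. f k x - f k (x + a))" for k
      using that Suc.prems(1)[of k] by simp
    show "(\<lambda>k. f k x - f k (x + a)) \<longlonglongrightarrow> g x - g (x + a)" if "x > 0" for x
      using that \<open>a > 0\<close> by (intro tendsto_diff Suc.prems(2)) auto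
  qed
  moreover have "0 \<le> g x" if "x > 0" for x
    using that Suc.prems(1) by (intro LIMSEQ_le_const[OF Suc.prems(2)]) auto
  ultimately show ?case by auto
qed

lemma cm_upto_const: "c \<ge> 0 \<Longrightarrow> cm_upto n (\<lambda>x. c)"
proof (induction n arbitrary: c)
  case (Suc n)
  then show ?case using Suc.IH[of 0] by auto
qed auto

lemma cm_upto_exp_neg: "c \<ge> 0 \<Longrightarrow> cm_upto n (\<lambda>x. exp (- (c * x)))"
proof (induction n)
  case (Suc n)
  have "cm_upto n (\<lambda>x. exp (- (c * x)) - exp (- (c * (x + a))))" if "a > 0" for a
  proof -
    have "cm_upto n (\<lambda>x. (1 - exp (- (c * a))) * exp (- (c * x)))"
      using Suc that by (intro cm_upto_scaleL) auto
    then show ?thesis by (simp add: algebra_simps exp_add [symmetric])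
  qed
  then show ?case by auto
qed auto

lemma cm_upto_sum:
  assumes "finite I" "\<And>i. i \<in> I \<Longrightarrow> cm_upto n (f i)"
  shows "cm_upto n (\<lambda>x. \<Sum>i\<in>I. f i x)"
  using assms
proof (induction I rule: finite_induct)
  case empty
  show ?case using cm_upto_const[of 0 n] by simp
next
  case (insert i I)
  then have "cm_upto n (\<lambda>x. f i x + (\<Sum>i\<in>I. f i x))"
    by (intro cm_upto_add) simp_all
  with insert.hyps show ?case by simp
qed

lemma cm_upto_power: "cm_upto n f \<Longrightarrow> cm_upto n (\<lambda>x. f x ^ k)"
proof (induction k)
  case 0
  show ?case using cm_upto_const[of 1 n] by simp
next
  case (Suc k)
  then show ?case using cm_upto_mult[of n f "\<lambda>x. f x ^ k"] by simp
qed

text \<open>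
  The power series of the exponential has nonnegative coefficients.
\<close>

lemma cm_upto_exp:
  assumes "cm_upto n f"
  shows "cm_upto n (\<lambda>x. exp (f x))"
proof -
  have "cm_upto n (\<lambda>x. (1 / fact i) * f x ^ i)" for i
    using cm_upto_scaleL[OF _ cm_upto_power[OF assms], of "1 / fact i" i] by simp
  then have "cm_upto n (\<lambda>x. \<Sum>i<k. (1 / fact i) * f x ^ i)" for k
    using cm_upto_sum[of "{..<k}" n "\<lambda>i x. (1 / fact i) * f x ^ i"] by simp
  moreover have "(\<lambda>k. \<Sum>i<k. (1 / fact i) * f x ^ i) \<longlonglongrightarrow> exp (f x)" for x
    using exp_converges[of "f x"] by (simp add: sums_def inverse_eq_divide)
  ultimately show ?thesis
    using cm_upto_lim[of n "\<lambda>k x. \<Sum>i<k. (1 / fact i) * f x ^ i" "\<lambda>x. exp (f x)"] by blast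
qed

lemma cm_upto_integral:
  assumes "\<And>y. y \<in> space M \<Longrightarrow> cm_upto n (f y)"
    and "\<And>x. x > 0 \<Longrightarrow> integrable M (\<lambda>y. f y x)"
  shows "cm_upto n (\<lambda>x. \<integral>y. f y x \<partial>M)"
  using assms
proof (induction n arbitrary: f)
  case 0
  then show ?case by (auto intro!: integral_nonneg_AE)
next
  case (Suc n)
  have "cm_upto n (\<lambda>x. (\<integral>y. f y x \<partial>M) - (\<integral>y. f y (x + a) \<partial>M))" if "a > 0" for a
  proof -
    have "cm_upto n (\<lambda>x. \<integral>y. (f y x - f y (x + a)) \<partial>M)"
      by (rule Suc.IH) (use Suc.prems that in auto)
    also have "?this \<longleftrightarrow> ?thesis"
      by (rule cm_upto_cong, rule Bochner_Integration.integral_diff) (use Suc.prems(2) that in auto)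
    finally show ?thesis .
  qed
  moreover have "0 \<le> (\<integral>y. f y x \<partial>M)" if "x > 0" for x
    using Suc.prems(1) that by (intro integral_nonneg_AE) auto
  ultimately show ?case by auto
qed

section \<open>Hausdorff's moment problem\<close>

primrec difference :: "nat \<Rightarrow> (nat \<Rightarrow> real) \<Rightarrow> nat \<Rightarrow> real" where
  "difference 0 a j = a j"
| "difference (Suc m) a j = difference m a j - difference m a (Suc j)"

lemma difference_nonneg:
  assumes "cm_upto m f" "x > 0"
  shows "difference m (\<lambda>j. f (x + real j)) j \<ge> 0"
proof -
  have shift: "difference m (\<lambda>j. a j - a (Suc j)) j = difference (Suc m) a j" for m a j
    by (induction m arbitrary: j) auto
  show ?thesis using assms
  proof (induction m arbitrary: f j)
    case 0
    then show ?case by auto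
  next
    case (Suc m)
    have "cm_upto m (\<lambda>x. f x - f (x + 1))"
      using Suc.prems by simp
    from Suc.IH[OF this Suc.prems(2), of j] show ?case
      by (subst shift[symmetric]) (simp add: add_ac)
  qed
qed

text \<open>
  The \<open>m\<close>-fold application of \<open>a j = difference 1 a j + a (Suc j)\<close>. For \<open>k = 0\<close> and \<open>j = 0\<close> the terms
  on the right are the weights of Hausdorff's approximating measures.
\<close>

lemma difference_expand:
  "difference k a j = (\<Sum>i\<le>m. real (m choose i) * difference (k + (m - i)) a (j + i))"
proof (induction m arbitrary: k j)
  case (Suc m)
  have *: "difference (k + (m - i)) a (j + i) =
      difference (k + (Suc m - i)) a (j + i) + difference (k + (m - i)) a (Suc (j + i))"
    if "i \<le> m" for i
    using that by (simp add: Suc_diff_le)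
  have "difference k a j = (\<Sum>i\<le>m. real (m choose i) *
      (difference (k + (Suc m - i)) a (j + i) + difference (k + (m - i)) a (Suc (j + i))))"
    unfolding Suc.IH[of k j] by (intro sum.cong refl) (use * in auto)
  also have "\<dots> = (\<Sum>i\<le>m. real (m choose i) * difference (k + (Suc m - i)) a (j + i)) +
      (\<Sum>i\<le>m. real (m choose i) * difference (k + (Suc m - Suc i)) a (j + Suc i))"
    by (simp only: distrib_left sum.distrib diff_Suc_Suc add_Suc_right)
  also have "(\<Sum>i\<le>m. real (m choose i) * difference (k + (Suc m - i)) a (j + i)) =
      (\<Sum>i\<le>Suc m. real (m choose i) * difference (k + (Suc m - i)) a (j + i))"
    by simp
  also have "\<dots> = difference (k + Suc m) a j +
      (\<Sum>i\<le>m. real (m choose Suc i) * difference (k + (Suc m - Suc i)) a (j + Suc i))"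
    by (subst sum.atMost_Suc_shift) simp
  also have "\<dots> + (\<Sum>i\<le>m. real (m choose i) * difference (k + (Suc m - Suc i)) a (j + Suc i)) =
     difference (k + Suc m) a j +
      (\<Sum>i\<le>m. real (Suc m choose Suc i) * difference (k + (Suc m - Suc i)) a (j + Suc i))"
    by (simp only: binomial_Suc_Suc of_nat_add distrib_right sum.distrib add_ac)
  also have "\<dots> = (\<Sum>i\<le>Suc m. real (Suc m choose i) * difference (k + (Suc m - i)) a (j + i))"
    by (subst sum.atMost_Suc_shift) simp
  finally show ?case .
qed auto

text \<open>
  Converts the weights for the expansion of \<open>a j\<close> into those for the expansion of \<open>a 0\<close>, so that all
  moments become integrals against a single discrete measure.
\<close>

lemma binomial_ratio:
  assumes "j \<le> N" "k \<le> N"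
  shows "real (N choose k) * (\<Prod>i<j. (real k - real i) / (real N - real i)) =
    (if j \<le> k then real ((N - j) choose (k - j)) else 0)"
  using assms(1)
proof (induction j)
  case (Suc j)
  have IH: "real (N choose k) * (\<Prod>i<j. (real k - real i) / (real N - real i)) =
    (if j \<le> k then real ((N - j) choose (k - j)) else 0)"
    using Suc by simp
  have eq: "real (N choose k) * (\<Prod>i<Suc j. (real k - real i) / (real N - real i)) =
     (if j \<le> k then real ((N - j) choose (k - j)) else 0) * ((real k - real j) / (real N - real j))"
    using IH by (simp add: mult.assoc[symmetric])
  consider "k < j" | "k = j" | "Suc j \<le> k" by linarith
  then show ?case
  proof cases
    case 3
    obtain n' k' where nk: "N - j = Suc n'" "k - j = Suc k'"
      using 3 Suc.prems by (metis Suc_diff_Suc Suc_le_eq)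
    have "Suc n' * (n' choose k') = (Suc n' choose Suc k') * Suc k'"
      by (rule Suc_times_binomial_eq)
    then have "real (Suc n') * real (n' choose k') = real (Suc n' choose Suc k') * real (Suc k')"
      by (metis of_nat_mult)
    moreover have "real k - real j = real (Suc k')" "real N - real j = real (Suc n')"
      using nk 3 Suc.prems by (simp_all flip: of_nat_diff)
    moreover have "N - Suc j = n'" "k - Suc j = k'" using nk by auto
    ultimately show ?thesis unfolding eq using 3 nk by (simp add: divide_simps mult.commute)
  qed (auto simp: eq)
qed auto

text \<open>
  The exact moments of the discrete measure are factorial moments; they differ little, uniformly in the
  position \<open>k\<close>, from the ordinary ones.
\<close>

lemma moment_approx:
  assumes "j > 0" "2 * j \<le> N" "k \<le> N"
  shows "\<bar>(\<Prod>i<j. (real k - real i) / (real N - real i)) - (real k / real N) ^ j\<bar> \<le> 2 * real j ^ 2 / real N"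
proof -
  have N: "N > 0" using assms by auto
  have *: "\<bar>(real k - real i) / (real N - real i) - real k / real N\<bar> \<le> 2 * real j / real N" if "i < j" for i
  proof -
    have pos: "real N - real i > 0" using that assms by auto
    have "(real k - real i) / (real N - real i) - real k / real N = - (real i * (real N - real k) / (real N * (real N - real i)))"
      using N pos by (simp add: field_simps)
    also have "\<bar>\<dots>\<bar> = real i * (real N - real k) / (real N * (real N - real i))"
      using N pos assms by (simp add: abs_mult)
    also have "\<dots> \<le> real j * real N / (real N * (real N / 2))"
      using N pos assms that by (intro frac_le mult_mono mult_nonneg_nonneg mult_pos_pos) auto
    also have "\<dots> = 2 * real j / real N" using N by (simp add: field_simps)
    finally show ?thesis .
  qed
  have "\<bar>(\<Prod>i<j. (real k - real i) / (real N - real i)) - (\<Prod>i<j. real k / real N)\<bar>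
      \<le> (\<Sum>i<j. \<bar>(real k - real i) / (real N - real i) - real k / real N\<bar>)"
    unfolding real_norm_def[symmetric]
  proof (rule norm_prod_diff)
    fix i assume i: "i \<in> {..<j}"
    have "\<bar>real k - real i\<bar> \<le> real N - real i" using i assms by auto
    then show "norm ((real k - real i) / (real N - real i)) \<le> 1"
      using i assms by (auto simp: divide_simps)
    show "norm (real k / real N) \<le> 1" using assms N by auto
  qed
  also have "\<dots> \<le> (\<Sum>i<j. 2 * real j / real N)" by (intro sum_mono *) auto
  finally show ?thesis by (simp add: power2_eq_square mult_ac)
qed

text \<open>
  The discrete measures with mass \<open>(N choose k) * difference (N - k) a k\<close> at \<open>k / N\<close> live on the unit
  interval, so they are tight, and a weak limit along a subsequence has the prescribed moments.
\<close>

lemma Hausdorff_moment_existence: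
  assumes nonneg: "\<And>m j. difference m a j \<ge> 0" and a0: "a 0 = 1"
  shows "\<exists>M :: real measure. real_distribution M \<and> (AE x in M. 0 \<le> x \<and> x \<le> 1) \<and> (\<forall>j. (\<integral>x. x ^ j \<partial>M) = a j)"
proof -
  define p where "p N k = real (N choose k) * difference (N - k) a k" for N k
  have p_nonneg: "p N k \<ge> 0" for N k unfolding p_def using nonneg by simp
  have p_sum: "(\<Sum>k\<le>N. p N k) = 1" for N
    using difference_expand[of 0 a 0 N] a0 by (simp add: p_def)
  have p_moment: "a j = (\<Sum>k\<le>N. p N k * (\<Prod>i<j. (real k - real i) / (real N - real i)))" if "j \<le> N" for j N
  proof -
    have "(\<Sum>k\<le>N. p N k * (\<Prod>i<j. (real k - real i) / (real N - real i))) =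
       (\<Sum>k\<le>N. (if j \<le> k then real ((N - j) choose (k - j)) else 0) * difference (N - k) a k)"
    proof (intro sum.cong refl)
      fix k assume k: "k \<in> {..N}"
      have "p N k * (\<Prod>i<j. (real k - real i) / (real N - real i)) =
        real (N choose k) * (\<Prod>i<j. (real k - real i) / (real N - real i)) * difference (N - k) a k"
        by (simp only: p_def mult_ac)
      also have "\<dots> = (if j \<le> k then real ((N - j) choose (k - j)) else 0) * difference (N - k) a k"
        using k that by (subst binomial_ratio) auto
      finally show "p N k * (\<Prod>i<j. (real k - real i) / (real N - real i)) =
        (if j \<le> k then real ((N - j) choose (k - j)) else 0) * difference (N - k) a k" .
    qed
    also have "\<dots> = (\<Sum>k\<in>{j..N}. real ((N - j) choose (k - j)) * difference (N - k) a k)"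
      by (intro sum.mono_neutral_cong_right) auto
    also have "\<dots> = (\<Sum>i\<le>N - j. real ((N - j) choose i) * difference (N - j - i) a (j + i))"
      by (rule sum.reindex_bij_witness[of _ "\<lambda>i. j + i" "\<lambda>k. k - j"]) (use that in auto)
    also have "\<dots> = a j" using difference_expand[of 0 a j "N - j"] by simp
    finally show ?thesis by simp
  qed
  define \<mu> where "\<mu> N = distr (point_measure {..N} (\<lambda>k. ennreal (p N k))) borel (\<lambda>k. real k / real N)" for N
  have int_\<mu>: "(\<integral>x. f x \<partial>\<mu> N) = (\<Sum>k\<le>N. p N k * f (real k / real N))"
    if [measurable]: "f \<in> borel_measurable borel" for f :: "real \<Rightarrow> real" and N
    unfolding \<mu>_def
    by (subst integral_distr) (auto simp: lebesgue_integral_point_measure_finite p_nonneg measurable_point_measure_eq1)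
  have \<mu>_real: "real_distribution (\<mu> N)" for N
  proof -
    have "prob_space (point_measure {..N} (\<lambda>k. ennreal (p N k)))"
      by (rule prob_spaceI) (simp add: emeasure_point_measure_finite space_point_measure sum_ennreal p_nonneg p_sum)
    then show ?thesis unfolding \<mu>_def
      by (intro real_distribution.intro prob_space.prob_space_distr)
         (auto simp: real_distribution_axioms_def measurable_point_measure_eq1)
  qed
  have "tight \<mu>" unfolding tight_def
  proof (intro conjI allI impI \<mu>_real)
    fix \<epsilon> :: real assume e: "\<epsilon> > 0"
    have "measure (\<mu> n) {-1<..2} = 1" for n
    proof -
      interpret real_distribution "\<mu> n" by (rule \<mu>_real)
      have "measure (\<mu> n) {-1<..2} = (\<integral>x. indicator {-1<..2} x \<partial>\<mu> n)" by simp
      also have "\<dots> = (\<Sum>k\<le>n. p n k * indicator {-1<..2} (real k / real n))"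
        by (rule int_\<mu>) auto
      also have "\<dots> = (\<Sum>k\<le>n. p n k)"
      proof (intro sum.cong refl)
        fix k assume k: "k \<in> {..n}"
        have "0 \<le> real k / real n" "real k / real n \<le> 1" using k by (auto simp: divide_simps)
        then have "real k / real n \<in> {-1<..2}" unfolding greaterThanAtMost_iff by linarith
        then show "p n k * indicator {-1<..2} (real k / real n) = p n k"
          by (simp only: indicator_simps)
      qed
      finally show ?thesis using p_sum by simp
    qed
    then show "\<exists>a b. a < b \<and> (\<forall>n. 1 - \<epsilon> < measure (\<mu> n) {a<..b})"
      using e by (intro exI[of _ "-1"] exI[of _ 2]) auto
  qed
  from tight_imp_convergent_subsubsequence[OF this, of id] obtain r M where
    r: "strict_mono (r :: nat \<Rightarrow> nat)" and M: "real_distribution M" and conv: "weak_conv_m (\<mu> \<circ> id \<circ> r) M"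
    by (auto simp: strict_mono_def)
  \<comment> \<open>The limit measure is pushed forward under a clamping function. This turns powers into bounded
    continuous functions on the line and places the mass on the unit interval, while the approximating
    measures are unaffected.\<close>
  define clamp where "clamp x = max 0 (min 1 x)" for x :: real
  have clamp_meas [measurable]: "clamp \<in> borel_measurable borel" unfolding clamp_def by measurable
  have clamp_01: "0 \<le> clamp x" "clamp x \<le> 1" for x by (auto simp: clamp_def)
  have cont: "isCont (\<lambda>x. clamp x ^ j) x" for j x
    unfolding clamp_def by (intro continuous_intros)
  have lim: "(\<lambda>N. \<integral>x. clamp x ^ j \<partial>\<mu> N) \<longlonglongrightarrow> a j" for j
  proof (cases "j = 0")
    case True
    have "(\<integral>x. (1::real) \<partial>\<mu> N) = 1" for N
      by (subst int_\<mu>) (simp_all add: p_sum)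
    then show ?thesis using True a0 by simp
  next
    case False
    have "(\<lambda>N. (\<integral>x. clamp x ^ j \<partial>\<mu> N) - a j) \<longlonglongrightarrow> 0"
    proof (rule Lim_null_comparison)
      show "eventually (\<lambda>N. norm ((\<integral>x. clamp x ^ j \<partial>\<mu> N) - a j) \<le> 2 * real j ^ 2 / real N) sequentially"
        using eventually_ge_at_top[of "2 * j"]
      proof eventually_elim
        case (elim N)
        have "(\<integral>x. clamp x ^ j \<partial>\<mu> N) = (\<Sum>k\<le>N. p N k * clamp (real k / real N) ^ j)"
          by (rule int_\<mu>) measurable
        also have "\<dots> = (\<Sum>k\<le>N. p N k * (real k / real N) ^ j)"
        proof (intro sum.cong refl)
          fix k assume k: "k \<in> {..N}"
          have "real k / real N \<in> {0..1}" using k by (auto simp: divide_simps)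
          then have "clamp (real k / real N) = real k / real N" by (auto simp: clamp_def)
          then show "p N k * clamp (real k / real N) ^ j = p N k * (real k / real N) ^ j" by simp
        qed
        finally have "a j - (\<integral>x. clamp x ^ j \<partial>\<mu> N) =
          (\<Sum>k\<le>N. p N k * ((\<Prod>i<j. (real k - real i) / (real N - real i)) - (real k / real N) ^ j))"
          using p_moment[of j N] elim by (simp add: algebra_simps sum_subtractf)
        also have "\<bar>\<dots>\<bar> \<le> (\<Sum>k\<le>N. p N k * (2 * real j ^ 2 / real N))"
        proof (rule order.trans[OF sum_abs sum_mono])
          fix k assume "k \<in> {..N}"
          then show "\<bar>p N k * ((\<Prod>i<j. (real k - real i) / (real N - real i)) - (real k / real N) ^ j)\<bar>
            \<le> p N k * (2 * real j ^ 2 / real N)"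
            using moment_approx[of j N k] False elim p_nonneg[of N k]
            unfolding abs_mult by (intro mult_mono) auto
        qed
        also have "\<dots> = 2 * real j ^ 2 / real N"
          by (simp only: sum_distrib_right[symmetric] p_sum mult_1)
        finally show ?case by (simp add: abs_minus_commute)
      qed
      show "(\<lambda>N. 2 * real j ^ 2 / real N) \<longlonglongrightarrow> 0" by real_asymp
    qed
    then show ?thesis by (simp add: LIM_zero_iff)
  qed
  have M_moment: "(\<integral>x. clamp x ^ j \<partial>M) = a j" for j
  proof -
    have "weak_conv_m (\<lambda>n. \<mu> (r n)) M" using conv by (simp add: comp_def)
    then have "(\<lambda>n. \<integral>x. clamp x ^ j \<partial>\<mu> (r n)) \<longlonglongrightarrow> (\<integral>x. clamp x ^ j \<partial>M)"
      by (intro weak_conv_imp_integral_bdd_continuous_conv[where B = 1] \<mu>_real M cont)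
         (simp_all add: clamp_01 power_le_one)
    moreover have "(\<lambda>n. \<integral>x. clamp x ^ j \<partial>\<mu> (r n)) \<longlonglongrightarrow> a j"
      using LIMSEQ_subseq_LIMSEQ[OF lim r, of j] by (simp add: comp_def)
    ultimately show ?thesis by (rule LIMSEQ_unique)
  qed
  interpret M: real_distribution M by (rule M)
  have clM [measurable]: "clamp \<in> borel_measurable M" by simp
  show ?thesis
  proof (intro exI[of _ "distr M borel clamp"] conjI allI)
    show "real_distribution (distr M borel clamp)"
      by (intro M.real_distribution_distr) simp
    show "AE x in distr M borel clamp. 0 \<le> x \<and> x \<le> 1"
      by (subst AE_distr_iff) (auto simp: clamp_01)
    show "(\<integral>x. x ^ j \<partial>distr M borel clamp) = a j" for j
      by (subst integral_distr) (auto simp: M_moment)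
  qed
qed

text \<open>
  By Weierstrass' theorem the moments determine the integrals of all continuous functions, in
  particular the characteristic function.
\<close>

lemma Hausdorff_moment_uniqueness:
  assumes M: "real_distribution M" "AE x in M. 0 \<le> x \<and> x \<le> 1"
    and N: "real_distribution N" "AE x in N. 0 \<le> x \<and> x \<le> 1"
    and eq: "\<And>j. (\<integral>x. x ^ j \<partial>M) = (\<integral>x. x ^ j \<partial>N)"
  shows "M = N"
proof -
  interpret M: real_distribution M by fact
  interpret N: real_distribution N by fact
  have int: "integrable P f" and close: "\<bar>(\<integral>x. f x \<partial>P) - (\<integral>x. g x \<partial>P)\<bar> \<le> e"
    if P: "real_distribution P" "AE x in P. 0 \<le> x \<and> x \<le> 1" and fg: "continuous_on UNIV f" "continuous_on UNIV g"
      and e: "\<And>x. x \<in> {0..1} \<Longrightarrow> \<bar>f x - g x\<bar> \<le> e" for P and f g :: "real \<Rightarrow> real" and e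
  proof -
    interpret P: real_distribution P by fact
    have int: "integrable P h" if "continuous_on UNIV h" for h :: "real \<Rightarrow> real"
    proof -
      have "compact (h ` {0..1})" 
        using that by (intro compact_continuous_image) (auto intro: continuous_on_subset)
      then have "bounded (h ` {0..1})" by (rule compact_imp_bounded)
      then obtain B where "\<And>x. x \<in> {0..1} \<Longrightarrow> norm (h x) \<le> B"
        unfolding bounded_iff by (metis imageI)
      then show ?thesis using P(2) borel_measurable_continuous_onI[OF that]
        by (intro P.integrable_const_bound[of _ B]) auto
    qed
    show "integrable P f" using int fg by auto
    have "\<bar>(\<integral>x. f x \<partial>P) - (\<integral>x. g x \<partial>P)\<bar> = \<bar>\<integral>x. f x - g x \<partial>P\<bar>"
      using int fg by simp
    also have "\<dots> \<le> (\<integral>x. \<bar>f x - g x\<bar> \<partial>P)" by (rule integral_abs_bound)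
    also have "\<dots> \<le> (\<integral>x. e \<partial>P)"
      using P(2) e by (intro integral_mono_AE) (auto intro!: int fg continuous_intros)
    also have "\<dots> = e" using P.prob_space by simp
    finally show "\<bar>(\<integral>x. f x \<partial>P) - (\<integral>x. g x \<partial>P)\<bar> \<le> e" .
  qed
  have cont_eq: "(\<integral>x. f x \<partial>M) = (\<integral>x. f x \<partial>N)" if f: "continuous_on UNIV f" for f :: "real \<Rightarrow> real"
  proof -
    have "\<bar>(\<integral>x. f x \<partial>M) - (\<integral>x. f x \<partial>N)\<bar> \<le> e" if e: "e > 0" for e
    proof -
      have "continuous_on {0..1} f" using f by (rule continuous_on_subset) auto
      then obtain g where g: "real_polynomial_function g" "\<And>x. x \<in> {0..1} \<Longrightarrow> \<bar>f x - g x\<bar> < e / 2"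
        using Stone_Weierstrass_real_polynomial_function[of "{0..1::real}" f "e / 2"] e by auto
      from g(1) obtain a n where g_eq: "g = (\<lambda>x. \<Sum>i\<le>n. a i * x ^ i)"
        by (auto simp: real_polynomial_function_iff_sum)
      have gc: "continuous_on UNIV g" unfolding g_eq by (intro continuous_intros)
      have pow: "integrable M (\<lambda>x. x ^ i)" "integrable N (\<lambda>x. x ^ i)" for i
        by (rule int[OF M, of _ "\<lambda>x. x ^ i" 0] int[OF N, of _ "\<lambda>x. x ^ i" 0]; auto intro!: continuous_intros)+
      have "(\<integral>x. g x \<partial>M) = (\<integral>x. g x \<partial>N)"
        unfolding g_eq using pow eq by simp
      moreover have "\<bar>(\<integral>x. f x \<partial>M) - (\<integral>x. g x \<partial>M)\<bar> \<le> e / 2" "\<bar>(\<integral>x. f x \<partial>N) - (\<integral>x. g x \<partial>N)\<bar> \<le> e / 2"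
        by (rule close[OF M f gc] close[OF N f gc]; rule less_imp_le[OF g(2)]; assumption)+
      ultimately show ?thesis by linarith
    qed
    then show ?thesis using field_le_epsilon[of "\<bar>(\<integral>x. f x \<partial>M) - (\<integral>x. f x \<partial>N)\<bar>" 0] by auto
  qed
  have "char M t = char N t" for t
  proof (rule complex_eqI)
    have i: "integrable P (\<lambda>x. iexp (t * x))" if "real_distribution P" for P
    proof -
      interpret P: real_distribution P by fact
      show ?thesis by (rule P.integrable_iexp) auto
    qed
    show "Re (char M t) = Re (char N t)"
      unfolding char_def using i[OF M(1)] i[OF N(1)]
      by (simp flip: integral_Re add: Re_exp cont_eq continuous_intros)
    show "Im (char M t) = Im (char N t)"
      unfolding char_def using i[OF M(1)] i[OF N(1)]
      by (simp flip: integral_Im add: Im_exp cont_eq continuous_intros)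
  qed
  then show ?thesis using Levy_uniqueness[OF M(1) N(1)] by auto
qed

section \<open>A Laplace transform criterion for self-decomposability\<close>

lemma (in finite_measure) integral_exp_pos:
  fixes f :: "'a \<Rightarrow> real"
  assumes pos: "0 < measure M (space M)" and int: "integrable M (\<lambda>\<omega>. exp (f \<omega>))"
  shows "0 < (\<integral>\<omega>. exp (f \<omega>) \<partial>M)"
proof -
  have "(\<integral>\<omega>. exp (f \<omega>) \<partial>M) \<noteq> 0"
  proof
    assume "(\<integral>\<omega>. exp (f \<omega>) \<partial>M) = 0"
    then have "AE \<omega> in M. exp (f \<omega>) = 0"
      using integral_nonneg_eq_0_iff_AE[OF int] by simp
    then have "AE \<omega> in M. False" by simp
    then have "measure M (space M) = 0"
      by (metis AE_iff_measurable[of "space M" M "\<lambda>_. False"] Collect_mem_eq measure_def enn2real_0 sets.top)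
    then show False using pos by simp
  qed
  moreover have "0 \<le> (\<integral>\<omega>. exp (f \<omega>) \<partial>M)" by (intro Bochner_Integration.integral_nonneg) auto
  ultimately show ?thesis by linarith
qed

text \<open>
  Let \<open>U\<close> have moments \<open>a j\<close> and be independent of a copy \<open>Y\<close> of \<open>X\<close>. Then \<open>V = exp (- c Y) * U\<close> has
  the same moments as \<open>exp (- X)\<close>, hence the same law. In particular \<open>V\<close>, and with it \<open>U\<close>, is almost
  surely positive, so that \<open>- ln U\<close> can serve as the independent summand.
\<close>

lemma self_decomposableI_difference:
  fixes M :: "'a measure" and X :: "'a \<Rightarrow> real"
  assumes M: "prob_space M" and X [measurable]: "X \<in> borel_measurable M"
    and nonneg: "AE \<omega> in M. 0 \<le> X \<omega>"
    and ratio: "\<And>c. 0 < c \<Longrightarrow> c < 1 \<Longrightarrow> \<exists>a. a 0 = 1 \<and> (\<forall>m j. 0 \<le> difference m a j) \<and>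
      (\<forall>j. a j * (\<integral>\<omega>. exp (- (real j * (c * X \<omega>))) \<partial>M) = (\<integral>\<omega>. exp (- (real j * X \<omega>)) \<partial>M))"
  shows "prob_space.self_decomposable M X"
proof -
  interpret M: prob_space M by (rule M)
  define D where "D = distr M borel X"
  interpret D: real_distribution D unfolding D_def by simp
  have D_nonneg: "AE x in D. 0 \<le> x"
    unfolding D_def using nonneg by (subst AE_distr_iff) auto
  have "\<exists>(N :: (real \<times> real) measure) Y Z. prob_space N \<and>
          prob_space.indep_var N borel Y borel Z \<and>
          distr N borel Y = distr M borel X \<and>
          distr N borel (\<lambda>\<omega>. c * Y \<omega> + Z \<omega>) = distr M borel X"
    if c: "0 < c" "c < 1" for c
  proof -
    from ratio[OF c] obtain a where a0: "a 0 = 1" and a_diff: "\<And>m j. 0 \<le> difference m a j"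
      and a: "\<And>j. a j * (\<integral>\<omega>. exp (- (real j * (c * X \<omega>))) \<partial>M) = (\<integral>\<omega>. exp (- (real j * X \<omega>)) \<partial>M)"
      by blast
    from Hausdorff_moment_existence[of a, OF a_diff a0] obtain L where
      L: "real_distribution L" "AE x in L. 0 \<le> x \<and> x \<le> 1" "\<And>j. (\<integral>x. x ^ j \<partial>L) = a j" by blast
    interpret L: real_distribution L by (rule L(1))
    define P where "P = D \<Otimes>\<^sub>M L"
    interpret DL: pair_prob_space D L ..
    interpret P: prob_space P unfolding P_def by (rule DL.prob_space_axioms)
    have sets_P [measurable_cong]: "sets P = sets (borel \<Otimes>\<^sub>M borel)"
      unfolding P_def by (intro sets_pair_measure_cong) auto
    have fst_distr: "distr P borel fst = D"
    proof -
      have "distr P borel fst = distr P D fst" by (intro distr_cong) auto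
      also have "\<dots> = D" unfolding P_def by (intro L.distr_pair_fst)
      finally show ?thesis .
    qed
    have snd_distr: "distr P borel snd = L"
    proof -
      have "distr P borel snd = distr P L snd" by (intro distr_cong) auto
      also have "\<dots> = distr (L \<Otimes>\<^sub>M D) L fst" unfolding P_def
        by (subst DL.distr_pair_swap, subst distr_distr) (auto simp: comp_def split_beta)
      also have "\<dots> = L" by (intro D.distr_pair_fst)
      finally show ?thesis .
    qed
    have indep: "P.indep_var borel fst borel snd"
      unfolding P.indep_var_distribution_eq fst_distr snd_distr
    proof (intro conjI)
      have "distr P (borel \<Otimes>\<^sub>M borel) (\<lambda>x. (fst x, snd x)) = distr P P (\<lambda>x. x)"
        using sets_P by (intro distr_cong) auto
      also have "\<dots> = P" by (rule distr_id)
      finally show "D \<Otimes>\<^sub>M L = distr P (borel \<Otimes>\<^sub>M borel) (\<lambda>x. (fst x, snd x))"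
        unfolding P_def by simp
    qed measurable
    have ae_P: "AE \<omega> in P. 0 \<le> fst \<omega>" "AE \<omega> in P. 0 \<le> snd \<omega> \<and> snd \<omega> \<le> 1"
      using AE_distrD[of fst P borel "\<lambda>x. 0 \<le> x"] AE_distrD[of snd P borel "\<lambda>x. 0 \<le> x \<and> x \<le> 1"]
      unfolding fst_distr snd_distr using D_nonneg L(2) by simp_all
    define V where "V \<omega> = exp (- (c * fst \<omega>)) * snd \<omega>" for \<omega> :: "real \<times> real"
    have V [measurable]: "V \<in> borel_measurable P" unfolding V_def by measurable
    have V_moment: "(\<integral>\<omega>. V \<omega> ^ j \<partial>P) = (\<integral>x. exp (- (real j * x)) \<partial>D)" for j
    proof -
      have ind: "P.indep_var borel (\<lambda>\<omega>. exp (- (real j * (c * fst \<omega>)))) borel (\<lambda>\<omega>. snd \<omega> ^ j)"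
        using P.indep_var_compose[OF indep, of "\<lambda>x. exp (- (real j * (c * x)))" borel "\<lambda>x. x ^ j" borel]
        by (simp add: comp_def)
      have "(\<integral>\<omega>. V \<omega> ^ j \<partial>P) = (\<integral>\<omega>. exp (- (real j * (c * fst \<omega>))) * snd \<omega> ^ j \<partial>P)"
        unfolding V_def by (simp add: power_mult_distrib exp_of_nat_mult[symmetric])
      also have "\<dots> = (\<integral>\<omega>. exp (- (real j * (c * fst \<omega>))) \<partial>P) * (\<integral>\<omega>. snd \<omega> ^ j \<partial>P)"
      proof (rule P.indep_var_lebesgue_integral[OF ind])
        show "integrable P (\<lambda>\<omega>. exp (- (real j * (c * fst \<omega>))))"
          using ae_P(1) c by (intro P.integrable_const_bound[of _ 1]) auto
        show "integrable P (\<lambda>\<omega>. snd \<omega> ^ j)"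
          using ae_P(2) by (intro P.integrable_const_bound[of _ 1]) (auto simp: power_le_one)
      qed
      also have "(\<integral>\<omega>. exp (- (real j * (c * fst \<omega>))) \<partial>P) = (\<integral>x. exp (- (real j * (c * x))) \<partial>D)"
        unfolding fst_distr[symmetric] by (subst integral_distr) auto
      also have "\<dots> = (\<integral>\<omega>. exp (- (real j * (c * X \<omega>))) \<partial>M)"
        unfolding D_def by (subst integral_distr) auto
      also have "(\<integral>\<omega>. snd \<omega> ^ j \<partial>P) = (\<integral>x. x ^ j \<partial>L)"
        unfolding snd_distr[symmetric] by (subst integral_distr) auto
      also have "\<dots> = a j" by (rule L(3))
      also have "(\<integral>\<omega>. exp (- (real j * (c * X \<omega>))) \<partial>M) * a j = (\<integral>\<omega>. exp (- (real j * X \<omega>)) \<partial>M)"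
        using a[of j] by (simp add: mult.commute)
      also have "\<dots> = (\<integral>x. exp (- (real j * x)) \<partial>D)"
        unfolding D_def by (subst integral_distr) auto
      finally show ?thesis .
    qed
    have V_distr: "distr P borel V = distr D borel (\<lambda>x. exp (- x))"
    proof (rule Hausdorff_moment_uniqueness)
      show "AE x in distr P borel V. 0 \<le> x \<and> x \<le> 1"
      proof (subst AE_distr_iff)
        show "AE \<omega> in P. 0 \<le> V \<omega> \<and> V \<omega> \<le> 1"
          using ae_P by eventually_elim (use c in \<open>auto simp: V_def intro!: mult_le_one\<close>)
      qed auto
      show "AE x in distr D borel (\<lambda>x. exp (- x)). 0 \<le> x \<and> x \<le> 1"
        using D_nonneg by (subst AE_distr_iff) auto
      show "(\<integral>x. x ^ j \<partial>distr P borel V) = (\<integral>x. x ^ j \<partial>distr D borel (\<lambda>x. exp (- x)))" for j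
        by (subst (1 2) integral_distr) (auto simp: V_moment exp_of_nat_mult[symmetric])
    qed auto
    have "AE x in distr P borel V. 0 < x"
      unfolding V_distr by (subst AE_distr_iff) auto
    then have "AE \<omega> in P. 0 < V \<omega>" by (subst (asm) AE_distr_iff) auto
    then have snd_pos: "AE \<omega> in P. 0 < snd \<omega>"
      by eventually_elim (auto simp: V_def zero_less_mult_iff)
    define Z where "Z \<omega> = - ln (snd \<omega>)" for \<omega> :: "real \<times> real"
    have "distr P borel (\<lambda>\<omega>. c * fst \<omega> + Z \<omega>) = distr P borel (\<lambda>\<omega>. - ln (V \<omega>))"
    proof (rule distr_cong_AE)
      show "AE \<omega> in P. c * fst \<omega> + Z \<omega> = - ln (V \<omega>)"
        using snd_pos by eventually_elim (auto simp: V_def Z_def ln_mult)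
    qed (auto simp: Z_def)
    also have "\<dots> = distr (distr P borel V) borel (\<lambda>x. - ln x)"
      by (subst distr_distr) (auto simp: comp_def)
    also have "\<dots> = distr D borel (\<lambda>x. x)"
      unfolding V_distr by (subst distr_distr) (auto simp: comp_def)
    also have "\<dots> = D" by (intro distr_id2) auto
    finally have sum: "distr P borel (\<lambda>\<omega>. c * fst \<omega> + Z \<omega>) = D" .
    have "P.indep_var borel fst borel Z"
      using P.indep_var_compose[OF indep, of "\<lambda>x. x" borel "\<lambda>x. - ln x" borel]
      by (simp add: comp_def Z_def[abs_def])
    then show ?thesis
      using sum fst_distr P.prob_space_axioms unfolding D_def by blast
  qed
  then show ?thesis unfolding M.self_decomposable_def by simp
qed

lemma difference_tendsto:
  assumes "\<And>j. (\<lambda>k. a k j) \<longlonglongrightarrow> b j"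
  shows "(\<lambda>k. difference m (a k) j) \<longlonglongrightarrow> difference m b j"
  by (induction m arbitrary: j) (auto intro!: assms tendsto_diff)

text \<open>
  Complete monotonicity of the quotient is known for positive arguments only, whereas the moment
  sequence starts at \<open>0\<close>; the gap is closed by the continuity of \<open>L\<close> at \<open>0\<close>.
\<close>

theorem self_decomposableI_cm:
  fixes M :: "'a measure" and X :: "'a \<Rightarrow> real"
  defines "L \<equiv> \<lambda>x. \<integral>\<omega>. exp (- (x * X \<omega>)) \<partial>M"
  assumes M: "prob_space M" and X [measurable]: "X \<in> borel_measurable M"
    and nonneg: "AE \<omega> in M. 0 \<le> X \<omega>"
    and cm: "\<And>c n. 0 < c \<Longrightarrow> c < 1 \<Longrightarrow> cm_upto n (\<lambda>x. L x / L (c * x))"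
  shows "prob_space.self_decomposable M X"
proof (rule self_decomposableI_difference[OF M X nonneg])
  interpret prob_space M by (rule M)
  fix c :: real assume c: "0 < c" "c < 1"
  have int: "integrable M (\<lambda>\<omega>. exp (- (x * X \<omega>)))" if "0 \<le> x" for x
    using nonneg that by (intro integrable_const_bound[of _ 1]) auto
  have L_pos: "0 < L x" if "0 \<le> x" for x
    unfolding L_def using int[OF that] by (intro integral_exp_pos) (simp_all add: prob_space)
  have L_lim: "(\<lambda>k. L (d * (1 / real (Suc k) + x))) \<longlonglongrightarrow> L (d * x)" if "0 \<le> x" "0 < d" for x d
    unfolding L_def
  proof (rule integral_dominated_convergence[where w = "\<lambda>_. 1"])
    show "AE \<omega> in M. (\<lambda>k. exp (- (d * (1 / real (Suc k) + x) * X \<omega>))) \<longlonglongrightarrow> exp (- (d * x * X \<omega>))"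
    proof (intro AE_I2 tendsto_exp tendsto_minus tendsto_mult tendsto_const)
      show "(\<lambda>k. 1 / real (Suc k) + x) \<longlonglongrightarrow> x" by real_asymp
    qed
    show "AE \<omega> in M. norm (exp (- (d * (1 / real (Suc k) + x) * X \<omega>))) \<le> 1" for k
      using nonneg by eventually_elim (use that in auto)
  qed auto
  define r where "r x = L x / L (c * x)" for x
  have "0 \<le> difference m (\<lambda>j. r (real j)) j" for m j
  proof (rule LIMSEQ_le_const)
    show "(\<lambda>k. difference m (\<lambda>j. r (1 / real (Suc k) + real j)) j) \<longlonglongrightarrow> difference m (\<lambda>j. r (real j)) j"
    proof (intro difference_tendsto)
      fix j
      show "(\<lambda>k. r (1 / real (Suc k) + real j)) \<longlonglongrightarrow> r (real j)"
        unfolding r_def using L_lim[of "real j" 1] L_lim[of "real j" c] L_pos[of "c * real j"] c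
        by (intro tendsto_divide) auto
    qed
    show "\<exists>N. \<forall>k\<ge>N. 0 \<le> difference m (\<lambda>j. r (1 / real (Suc k) + real j)) j"
      using difference_nonneg[OF cm[OF c], of "1 / real (Suc _)"] unfolding r_def by auto
  qed
  moreover have "r (real j) * L (real j * c) = L (real j)" for j
    unfolding r_def using L_pos[of "c * real j"] c by (simp add: mult.commute)
  moreover have "r (real 0) = 1" unfolding r_def using L_pos[of 0] by simp
  ultimately show "\<exists>a. a 0 = 1 \<and> (\<forall>m j. 0 \<le> difference m a j) \<and>
      (\<forall>j. a j * (\<integral>\<omega>. exp (- (real j * (c * X \<omega>))) \<partial>M) = (\<integral>\<omega>. exp (- (real j * X \<omega>)) \<partial>M))"
    unfolding L_def by (intro exI[of _ "\<lambda>j. r (real j)"]) (simp add: mult.assoc)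
qed

section \<open>A nonlinear operator preserving complete monotonicity\<close>

lemma cm_upto_antimono:
  assumes "cm_upto 1 u" "0 < x" "x \<le> y"
  shows "u y \<le> u x"
proof (cases "x = y")
  case False
  have "\<forall>a>0. u (x + a) \<le> u x" using assms by simp
  from this[rule_format, of "y - x"] show ?thesis using False assms by simp
qed simp

lemma cm_integrable_exp_orbit:
  assumes "cm_upto 1 u" "0 < x"
  shows "integrable (lebesgue_on {0..y}) (\<lambda>z. u (x * exp z))"
proof -
  have "mono_on {0..y} (\<lambda>z. - u (x * exp z))"
    unfolding mono_on_def neg_le_iff_le
    using assms by (intro allI impI cm_upto_antimono[of u]) simp_all
  from integrable_mono_on[OF this] show ?thesis by simp
qed

lemma cm_upto_exp_orbit_integral:
  assumes "\<And>n. cm_upto n u"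
  shows "cm_upto n (\<lambda>x. integral {0..y} (\<lambda>z. u (x * exp z)))"
proof -
  have "cm_upto n (\<lambda>x. \<integral>z. u (x * exp z) \<partial>lebesgue_on {0..y})"
  proof (rule cm_upto_integral)
    show "cm_upto n (\<lambda>x. u (x * exp z))" for z
      using cm_upto_dilate[of "exp z" n u] assms by (simp add: mult.commute)
  qed (rule cm_integrable_exp_orbit[OF assms])
  also have "?this \<longleftrightarrow> ?thesis"
    by (rule cm_upto_cong, rule lebesgue_integral_eq_integral, rule cm_integrable_exp_orbit[OF assms])
      simp_all
  finally show ?thesis .
qed

lemma abs_exp_diff_le:
  fixes a b :: real
  assumes "a \<le> 0" "b \<le> 0"
  shows "\<bar>exp a - exp b\<bar> \<le> \<bar>a - b\<bar>"
proof -
  have *: "exp b - exp a \<le> b - a" if "a \<le> b" "b \<le> 0" for a b :: real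
  proof -
    have "exp b - exp a = exp b * (1 - exp (a - b))" by (simp add: right_diff_distrib exp_diff)
    also have "\<dots> \<le> 1 * (b - a)"
    proof (rule mult_mono)
      show "1 - exp (a - b) \<le> b - a" using exp_ge_add_one_self[of "a - b"] by linarith
    qed (use that in auto)
    finally show ?thesis by simp
  qed
  show ?thesis
    using *[of a b] *[of b a] assms by (cases "a \<le> b") auto
qed

text \<open>
  The measure \<open>K\<close> with the map \<open>Y\<close> describes the rates and the sizes of the downward jumps of the
  underlying process.
\<close>

locale jump_operator = finite_measure K for K :: "'b measure" +
  fixes Y :: "'b \<Rightarrow> real"
  assumes Y [measurable]: "Y \<in> borel_measurable K"
    and Y_nonneg: "\<And>y. y \<in> space K \<Longrightarrow> 0 \<le> Y y"
begin

definition "mass = measure K (space K)"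

text \<open>
  The functions on which the operator below is defined and contracting.
\<close>

definition admissible :: "(real \<Rightarrow> real) \<Rightarrow> bool" where
  "admissible u \<longleftrightarrow> (\<forall>x>0. 0 \<le> u x \<and> u x \<le> mass \<and> (\<forall>y. (\<lambda>z. u (x * exp z)) integrable_on {0..y}))"

text \<open>
  If \<open>\<phi>\<close> satisfies \<open>- x * \<phi>' x = \<phi> x * (x + mass - u x)\<close>, then integrating the logarithmic
  derivative of \<open>\<phi>\<close> along the orbit \<open>z \<mapsto> x * exp z\<close> shows that \<open>kern u x y\<close> equals
  \<open>\<phi> (x * exp y) / \<phi> x\<close>.
\<close>

definition kern :: "(real \<Rightarrow> real) \<Rightarrow> real \<Rightarrow> real \<Rightarrow> real" where
  "kern u x y = exp (- (x * (exp y - 1)) - mass * y + integral {0..y} (\<lambda>z. u (x * exp z)))"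

definition jump_op :: "(real \<Rightarrow> real) \<Rightarrow> real \<Rightarrow> real" where
  "jump_op u x = (\<integral>y. kern u x (Y y) \<partial>K)"

lemma mass_nonneg: "0 \<le> mass" by (simp add: mass_def)

lemma orbit_integral_bounds:
  assumes "admissible u" "0 < x"
  shows "0 \<le> integral {0..y} (\<lambda>z. u (x * exp z))"
    and "0 \<le> y \<Longrightarrow> integral {0..y} (\<lambda>z. u (x * exp z)) \<le> mass * y"
proof -
  have i: "(\<lambda>z. u (x * exp z)) integrable_on {0..y}" using assms by (auto simp: admissible_def)
  show "0 \<le> integral {0..y} (\<lambda>z. u (x * exp z))"
    using assms by (intro Henstock_Kurzweil_Integration.integral_nonneg i) (auto simp: admissible_def)
  assume "0 \<le> y"
  have "integral {0..y} (\<lambda>z. u (x * exp z)) \<le> integral {0..y} (\<lambda>z. mass)"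
    using assms by (intro integral_le i) (auto simp: admissible_def)
  then show "integral {0..y} (\<lambda>z. u (x * exp z)) \<le> mass * y"
    using \<open>0 \<le> y\<close> by (simp add: mult.commute)
qed

lemma kern_bounds:
  assumes "admissible u" "0 < x" "0 \<le> y"
  shows "0 \<le> kern u x y" "kern u x y \<le> 1"
proof -
  have "- (x * (exp y - 1)) \<le> 0" using assms by auto
  then show "kern u x y \<le> 1"
    using orbit_integral_bounds(2)[OF assms] by (simp add: kern_def)
qed (simp add: kern_def)

lemma kern_measurable:
  assumes "admissible u" "0 < x"
  shows "(\<lambda>y. kern u x (Y y)) \<in> borel_measurable K"
proof -
  have "mono (\<lambda>y. integral {0..y} (\<lambda>z. u (x * exp z)))"
  proof (rule monoI)
    fix y y' :: real assume "y \<le> y'"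
    then show "integral {0..y} (\<lambda>z. u (x * exp z)) \<le> integral {0..y'} (\<lambda>z. u (x * exp z))"
      using assms by (intro integral_subset_le) (auto simp: admissible_def)
  qed
  then have [measurable]: "(\<lambda>y. integral {0..y} (\<lambda>z. u (x * exp z))) \<in> borel_measurable borel"
    by (rule borel_measurable_mono)
  have "kern u x \<in> borel_measurable borel"
    unfolding kern_def[abs_def] by measurable
  from measurable_compose[OF Y this] show ?thesis .
qed

lemma kern_integrable:
  assumes "admissible u" "0 < x"
  shows "integrable K (\<lambda>y. kern u x (Y y))"
  using kern_bounds[OF assms] Y_nonneg
  by (intro integrable_const_bound[of _ 1] kern_measurable[OF assms] AE_I2) auto

lemma cm_admissible:
  assumes "\<And>n. cm_upto n u" "\<And>x. 0 < x \<Longrightarrow> u x \<le> mass"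
  shows "admissible u"
  unfolding admissible_def
proof (intro allI impI conjI)
  fix x y :: real assume x: "0 < x"
  show "0 \<le> u x" using cm_upto_nonneg[OF assms(1) x] .
  show "u x \<le> mass" by (rule assms(2)[OF x])
  show "(\<lambda>z. u (x * exp z)) integrable_on {0..y}"
    using cm_integrable_exp_orbit[OF assms(1) x, of y]
    by (rule integrable_on_lebesgue_on) simp
qed

text \<open>
  The factor \<open>exp (- (mass * y))\<close> is a constant, and the integral over the orbit is an average of
  dilations of \<open>u\<close>. Only the argument is dilated, so complete monotonicity in \<open>x\<close> is kept.
\<close>

lemma kern_cm:
  assumes u: "\<And>n. cm_upto n u" and y: "0 \<le> y"
  shows "cm_upto n (\<lambda>x. kern u x y)"
proof -
  have "cm_upto n (\<lambda>x. exp (- ((exp y - 1) * x)))"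
    using y by (intro cm_upto_exp_neg) simp
  moreover have "cm_upto n (\<lambda>x. exp (- (mass * y)) * exp (integral {0..y} (\<lambda>z. u (x * exp z))))"
    by (rule cm_upto_scaleL, simp, rule cm_upto_exp, rule cm_upto_exp_orbit_integral, rule u)
  ultimately have "cm_upto n (\<lambda>x. exp (- ((exp y - 1) * x)) *
      (exp (- (mass * y)) * exp (integral {0..y} (\<lambda>z. u (x * exp z)))))"
    by (rule cm_upto_mult)
  also have "?this \<longleftrightarrow> ?thesis"
    by (rule cm_upto_cong) (simp add: kern_def exp_add exp_diff exp_minus mult.commute divide_simps)
  finally show ?thesis .
qed

lemma jump_op_cm:
  assumes u: "\<And>n. cm_upto n u" "\<And>x. 0 < x \<Longrightarrow> u x \<le> mass"
  shows "cm_upto n (jump_op u)" and "0 < x \<Longrightarrow> jump_op u x \<le> mass"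
proof -
  note adm = cm_admissible[OF u]
  show "cm_upto n (jump_op u)"
    unfolding jump_op_def[abs_def]
    by (rule cm_upto_integral, rule kern_cm[OF u(1)], erule Y_nonneg, rule kern_integrable[OF adm])
  assume x: "0 < x"
  have "jump_op u x \<le> (\<integral>y. 1 \<partial>K)"
    unfolding jump_op_def using kern_bounds[OF adm x] Y_nonneg
    by (intro integral_mono kern_integrable[OF adm x]) auto
  then show "jump_op u x \<le> mass" by (simp add: mass_def)
qed

text \<open>
  The weight \<open>exp x / x ^ p\<close> is chosen such that its growth along an orbit is absorbed by the factor
  \<open>exp (- (x * (exp y - 1)))\<close> of the kernel, while \<open>x ^ p\<close> contributes \<open>exp (- (p * z))\<close>, whose integral
  is at most \<open>1 / p\<close>.
\<close>

lemma kern_contraction: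
  assumes u: "admissible u" and v: "admissible v" and D: "0 \<le> D" and p: "0 < p"
    and bound: "\<And>x. 0 < x \<Longrightarrow> \<bar>u x - v x\<bar> \<le> D * exp x / x ^ p"
    and x: "0 < x" and y: "0 \<le> y"
  shows "\<bar>kern u x y - kern v x y\<bar> \<le> D * exp x / (p * x ^ p)"
proof -
  define I where "I w = integral {0..y} (\<lambda>z. w (x * exp z))" for w :: "real \<Rightarrow> real"
  define e where "e w = - mass * y + I w" for w
  have kern: "kern w x y = exp (- (x * (exp y - 1))) * exp (e w)" for w
    by (simp add: kern_def e_def I_def exp_add[symmetric] algebra_simps)
  have int: "(\<lambda>z. w (x * exp z)) integrable_on {0..y}" if "admissible w" for w
    using that x by (simp add: admissible_def)
  have e_neg: "e w \<le> 0" if "admissible w" for w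
    using orbit_integral_bounds(2)[OF that x y] by (simp add: e_def I_def)
  have p_int: "((\<lambda>z. exp (- (p * z))) has_integral (1 - exp (- (p * y))) / p) {0..y}"
  proof -
    let ?F = "\<lambda>z. - exp (- (real p * z)) / real p"
    have "((\<lambda>z. exp (- (real p * z))) has_integral (?F y - ?F 0)) {0..y}"
      using y p by (intro fundamental_theorem_of_calculus)
        (auto intro!: derivative_eq_intros simp flip: has_real_derivative_iff_has_vector_derivative)
    then show ?thesis by (simp add: diff_divide_distrib)
  qed
  have "\<bar>I u - I v\<bar> = norm (integral {0..y} (\<lambda>z. u (x * exp z) - v (x * exp z)))"
    unfolding I_def by (simp add: Henstock_Kurzweil_Integration.integral_diff int u v)
  also have "\<dots> \<le> integral {0..y} (\<lambda>z. D * exp (x * exp y) / x ^ p * exp (- (p * z)))"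
  proof (rule integral_norm_bound_integral)
    show "(\<lambda>z. u (x * exp z) - v (x * exp z)) integrable_on {0..y}"
      by (intro integrable_diff int u v)
    show "(\<lambda>z. D * exp (x * exp y) / x ^ p * exp (- (p * z))) integrable_on {0..y}"
      using p_int by (intro integrable_on_mult_right) (auto simp: integrable_on_def)
    fix z assume z: "z \<in> {0..y}"
    have "norm (u (x * exp z) - v (x * exp z)) \<le> D * exp (x * exp z) / (x * exp z) ^ p"
      using bound[of "x * exp z"] x by simp
    also have "\<dots> = D * exp (x * exp z) / x ^ p * exp (- (p * z))"
      by (simp add: power_mult_distrib exp_of_nat_mult[symmetric] exp_minus divide_simps)
    also have "\<dots> \<le> D * exp (x * exp y) / x ^ p * exp (- (p * z))"
      using z x D by (intro mult_right_mono divide_right_mono mult_left_mono) auto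
    finally show "norm (u (x * exp z) - v (x * exp z)) \<le> D * exp (x * exp y) / x ^ p * exp (- (p * z))" .
  qed
  also have "\<dots> = D * exp (x * exp y) / x ^ p * ((1 - exp (- (p * y))) / p)"
    using integral_unique[OF p_int] by simp
  also have "\<dots> \<le> D * exp (x * exp y) / x ^ p * (1 / p)"
    using D x p by (intro mult_left_mono divide_right_mono) auto
  finally have I: "\<bar>I u - I v\<bar> \<le> D * exp (x * exp y) / (p * x ^ p)" by (simp add: mult.commute)
  have "\<bar>kern u x y - kern v x y\<bar> = exp (- (x * (exp y - 1))) * \<bar>exp (e u) - exp (e v)\<bar>"
    unfolding kern by (simp flip: right_diff_distrib add: abs_mult)
  also have "\<dots> \<le> exp (- (x * (exp y - 1))) * \<bar>e u - e v\<bar>"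
    using e_neg u v by (intro mult_left_mono abs_exp_diff_le) auto
  also have "\<bar>e u - e v\<bar> = \<bar>I u - I v\<bar>" by (simp add: e_def)
  also have "exp (- (x * (exp y - 1))) * \<bar>I u - I v\<bar> \<le> exp (- (x * (exp y - 1))) * (D * exp (x * exp y) / (p * x ^ p))"
    using I by (intro mult_left_mono) auto
  also have "\<dots> = D * (exp (- (x * (exp y - 1))) * exp (x * exp y)) / (p * x ^ p)"
    by simp
  also have "exp (- (x * (exp y - 1))) * exp (x * exp y) = exp x"
    by (simp add: exp_add[symmetric] algebra_simps)
  finally show ?thesis .
qed

lemma jump_op_contraction:
  assumes u: "admissible u" and v: "admissible v" and D: "0 \<le> D" and p: "0 < p"
    and bound: "\<And>x. 0 < x \<Longrightarrow> \<bar>u x - v x\<bar> \<le> D * exp x / x ^ p" and x: "0 < x"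
  shows "\<bar>jump_op u x - jump_op v x\<bar> \<le> (mass / p * D) * exp x / x ^ p"
proof -
  have "\<bar>jump_op u x - jump_op v x\<bar> = \<bar>\<integral>y. (kern u x (Y y) - kern v x (Y y)) \<partial>K\<bar>"
    unfolding jump_op_def by (simp add: kern_integrable u v x)
  also have "\<dots> \<le> (\<integral>y. \<bar>kern u x (Y y) - kern v x (Y y)\<bar> \<partial>K)" by (rule integral_abs_bound)
  also have "\<dots> \<le> (\<integral>y. D * exp x / (p * x ^ p) \<partial>K)"
    using kern_contraction[OF u v D p bound x] Y_nonneg
    by (intro integral_mono Bochner_Integration.integrable_abs Bochner_Integration.integrable_diff
        kern_integrable u v x) auto
  also have "\<dots> = (mass / p * D) * exp x / x ^ p" by (simp add: mass_def)
  finally show ?thesis .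
qed

text \<open>
  With \<open>p\<close> at least twice the mass the error of the iterates is halved in every step. The error of the
  first iterate has finite weighted norm because \<open>x ^ p / fact p \<le> exp x\<close>.
\<close>

theorem fixed_point_cm:
  assumes g: "admissible g" and fixp: "\<And>x. 0 < x \<Longrightarrow> jump_op g x = g x"
  shows "cm_upto n g"
proof -
  obtain p :: nat where p: "0 < p" "2 * mass \<le> p"
    using reals_Archimedean2[of "max 1 (2 * mass)"] by (metis le_less_linear max.strict_boundedE
        less_eq_real_def of_nat_0_less_iff order_less_trans zero_less_one)
  define u where "u k = (jump_op ^^ k) (\<lambda>_. 0)" for k
  have u_Suc: "u (Suc k) = jump_op (u k)" for k by (simp add: u_def)
  have cm: "(\<forall>n. cm_upto n (u k)) \<and> (\<forall>x>0. u k x \<le> mass)" for k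
  proof (induction k)
    case 0
    show ?case using mass_nonneg cm_upto_const[of 0] by (simp add: u_def)
  next
    case (Suc k)
    then show ?case unfolding u_Suc using jump_op_cm[of "u k"] by auto
  qed
  have adm: "admissible (u k)" for k using cm[of k] cm_admissible[of "u k"] by blast
  define D where "D = mass * fact p"
  have D: "0 \<le> D" using mass_nonneg by (simp add: D_def)
  have err: "\<bar>u k x - g x\<bar> \<le> (D / 2 ^ k) * exp x / x ^ p" if "0 < x" for k x
    using that
  proof (induction k arbitrary: x)
    case 0
    have "x ^ p / fact p \<le> exp x"
    proof -
      have "(\<Sum>i\<in>{p}. x ^ i /\<^sub>R fact i) \<le> (\<Sum>i. x ^ i /\<^sub>R fact i)"
        using 0 by (intro sum_le_suminf summable_exp_generic) auto
      then show ?thesis by (simp add: exp_def divide_inverse mult.commute)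
    qed
    then have "1 \<le> fact p * exp x / x ^ p" using 0 by (simp add: divide_simps mult.commute)
    then have "mass * 1 \<le> mass * (fact p * exp x / x ^ p)" by (intro mult_left_mono mass_nonneg)
    moreover have "\<bar>u 0 x - g x\<bar> \<le> mass" using g 0 by (auto simp: u_def admissible_def)
    ultimately show ?case by (simp add: D_def)
  next
    case (Suc k)
    have "\<bar>u (Suc k) x - g x\<bar> = \<bar>jump_op (u k) x - jump_op g x\<bar>"
      using fixp[OF Suc.prems] by (simp add: u_Suc)
    also have "\<dots> \<le> (mass / p * (D / 2 ^ k)) * exp x / x ^ p"
      using Suc D p by (intro jump_op_contraction adm g) auto
    also have "\<dots> \<le> (1 / 2 * (D / 2 ^ k)) * exp x / x ^ p"
      using p D Suc.prems by (intro divide_right_mono mult_right_mono) (auto simp: divide_simps)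
    finally show ?case by simp
  qed
  show ?thesis
  proof (rule cm_upto_lim)
    show "cm_upto n (u k)" for k using cm by blast
    fix x :: real assume x: "0 < x"
    have "(\<lambda>k. u k x - g x) \<longlonglongrightarrow> 0"
    proof (rule Lim_null_comparison)
      show "\<forall>\<^sub>F k in sequentially. norm (u k x - g x) \<le> (D / 2 ^ k) * exp x / x ^ p"
        using err[OF x] by simp
      have "(\<lambda>k. (D * exp x / x ^ p) * (1 / 2) ^ k) \<longlonglongrightarrow> (D * exp x / x ^ p) * 0"
        by (intro tendsto_mult tendsto_const LIMSEQ_realpow_zero) auto
      then show "(\<lambda>k. (D / 2 ^ k) * exp x / x ^ p) \<longlonglongrightarrow> 0"
        by (simp add: power_divide mult.commute)
    qed
    then show "(\<lambda>k. u k x) \<longlonglongrightarrow> g x" by (simp add: LIM_zero_iff)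
  qed
qed

end

section \<open>The integral equation behind a moment recursion\<close>

lemma exp_second_order_bound:
  fixes x :: real
  shows "\<bar>exp x - 1 - x\<bar> \<le> x\<^sup>2 * exp \<bar>x\<bar>"
proof -
  have "1 - x \<le> exp (- x)" using exp_ge_add_one_self[of "- x"] by simp
  then have "(1 - x) * exp x \<le> exp (- x) * exp x" by (intro mult_right_mono) auto
  then have "exp x - 1 - x \<le> x * (exp x - 1)" by (simp add: exp_minus algebra_simps)
  also have "x * (exp x - 1) \<le> x\<^sup>2 * exp \<bar>x\<bar>"
  proof (cases "x \<ge> 0")
    case True
    have "exp x - 1 \<le> x * exp x" using \<open>(1 - x) * exp x \<le> exp (- x) * exp x\<close>
      by (simp add: exp_minus algebra_simps)
    then have "x * (exp x - 1) \<le> x * (x * exp x)" using True by (intro mult_left_mono)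
    then show ?thesis using True by (simp add: power2_eq_square mult.assoc)
  next
    case False
    have "1 - exp x \<le> - x" using exp_ge_add_one_self[of x] by linarith
    then have "(- x) * (1 - exp x) \<le> (- x) * (- x)" using False by (intro mult_left_mono) auto
    then have "x * (exp x - 1) \<le> x\<^sup>2 * 1" by (simp add: power2_eq_square algebra_simps)
    also have "\<dots> \<le> x\<^sup>2 * exp \<bar>x\<bar>" by (intro mult_left_mono) auto
    finally show ?thesis .
  qed
  finally have "exp x - 1 - x \<le> x\<^sup>2 * exp \<bar>x\<bar>" .
  moreover have "0 \<le> exp x - 1 - x" using exp_ge_add_one_self[of x] by linarith
  ultimately show ?thesis by (simp only: abs_of_nonneg)
qed

lemma exp_neg_mult_bounds:
  fixes x v :: real
  assumes "0 < x" "0 \<le> v"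
  shows "v * exp (- (x * v)) \<le> 1 / x" and "v\<^sup>2 * exp (- (x * v)) \<le> 2 / x\<^sup>2"
proof -
  have q: "1 + x * v + (x * v)\<^sup>2 / 2 \<le> exp (x * v)"
    using assms by (intro exp_lower_Taylor_quadratic) auto
  have nn: "0 \<le> x * v" "0 \<le> (x * v)\<^sup>2" using assms by auto
  have "x * v \<le> exp (x * v)" "(x * v)\<^sup>2 \<le> 2 * exp (x * v)" using q nn by linarith+
  then show "v * exp (- (x * v)) \<le> 1 / x" "v\<^sup>2 * exp (- (x * v)) \<le> 2 / x\<^sup>2"
    using assms by (auto simp: exp_minus divide_simps power_mult_distrib mult.commute)
qed

lemma (in finite_measure) integrable_bounded:
  fixes f :: "'a \<Rightarrow> real"
  assumes "f \<in> borel_measurable M" "\<And>\<omega>. \<omega> \<in> space M \<Longrightarrow> \<bar>f \<omega>\<bar> \<le> B"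
  shows "integrable M f"
  using assms by (intro integrable_const_bound[of _ B] AE_I2) auto

lemma (in finite_measure) integral_bounded:
  fixes f :: "'a \<Rightarrow> real"
  assumes "f \<in> borel_measurable M" "\<And>\<omega>. \<omega> \<in> space M \<Longrightarrow> \<bar>f \<omega>\<bar> \<le> B"
  shows "\<bar>\<integral>\<omega>. f \<omega> \<partial>M\<bar> \<le> B * measure M (space M)"
proof -
  have "\<bar>\<integral>\<omega>. f \<omega> \<partial>M\<bar> \<le> (\<integral>\<omega>. \<bar>f \<omega>\<bar> \<partial>M)" by (rule integral_abs_bound)
  also have "\<dots> \<le> (\<integral>\<omega>. B \<partial>M)"
    using assms by (intro integral_mono Bochner_Integration.integrable_abs integrable_bounded[OF assms]) auto
  finally show ?thesis by (simp add: mult.commute)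
qed

text \<open>
  The generator equation to be established reads: the integral of \<open>W * (1 - W) * G' W\<close> equals that of
  \<open>G W - G (W * exp (- Y))\<close> over both measures. The assumption \<open>recursion\<close> is this equation for
  \<open>G w = w ^ s\<close>.
\<close>

locale moment_recursion = jump_operator K Y + M: finite_measure M
  for K :: "'b measure" and Y :: "'b \<Rightarrow> real" and M :: "'a measure" +
  fixes W :: "'a \<Rightarrow> real"
  assumes W [measurable]: "W \<in> borel_measurable M"
    and W_pos: "\<And>\<omega>. \<omega> \<in> space M \<Longrightarrow> 0 < W \<omega>"
    and W_le_1: "\<And>\<omega>. \<omega> \<in> space M \<Longrightarrow> W \<omega> \<le> 1"
    and M_pos: "0 < measure M (space M)"
    and recursion: "\<And>s. real s * ((\<integral>\<omega>. W \<omega> ^ s \<partial>M) - (\<integral>\<omega>. W \<omega> ^ Suc s \<partial>M)) =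
        (\<integral>\<omega>. W \<omega> ^ s \<partial>M) * (\<integral>y. 1 - exp (- (real s * Y y)) \<partial>K)"
begin

text \<open>
  The Laplace transform of the law of \<open>1 / W\<close>, and minus its derivative.
\<close>

definition "\<phi> x = (\<integral>\<omega>. exp (- (x / W \<omega>)) \<partial>M)"
definition "\<psi> x = (\<integral>\<omega>. exp (- (x / W \<omega>)) / W \<omega> \<partial>M)"

lemma integrable_\<phi>: "0 \<le> x \<Longrightarrow> integrable M (\<lambda>\<omega>. exp (- (x / W \<omega>)))"
  using W_pos by (intro M.integrable_bounded[of _ 1]) (auto intro!: divide_nonneg_pos)

lemma integrable_\<psi>:
  assumes "0 < x" shows "integrable M (\<lambda>\<omega>. exp (- (x / W \<omega>)) / W \<omega>)"
proof (rule M.integrable_bounded)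
  fix \<omega> assume "\<omega> \<in> space M"
  then show "\<bar>exp (- (x / W \<omega>)) / W \<omega>\<bar> \<le> 1 / x"
    using exp_neg_mult_bounds(1)[OF assms, of "1 / W \<omega>"] W_pos[of \<omega>] by simp
qed measurable

lemma \<phi>_pos: assumes "0 \<le> x" shows "0 < \<phi> x"
  unfolding \<phi>_def by (rule M.integral_exp_pos[OF M_pos integrable_\<phi>[OF assms]])

lemma \<phi>_antimono: assumes "0 \<le> x" "x \<le> y" shows "\<phi> y \<le> \<phi> x"
  unfolding \<phi>_def using assms W_pos
  by (intro integral_mono integrable_\<phi>) (auto simp: divide_right_mono less_imp_le)

text \<open>
  The difference quotient is estimated by Taylor's formula; the second moment of \<open>1 / W\<close> that appears is
  tempered by the factor \<open>exp (- (x / (2 * W)))\<close>.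
\<close>

lemma \<phi>_deriv:
  assumes x: "0 < x"
  shows "(\<phi> has_real_derivative - \<psi> x) (at x)"
proof -
  define B where "B = 8 / x\<^sup>2 * measure M (space M)"
  have est: "\<bar>\<phi> (x + h) - \<phi> x + h * \<psi> x\<bar> \<le> B * h\<^sup>2" if h: "\<bar>h\<bar> \<le> x / 2" for h
  proof -
    have xh: "0 \<le> x + h" using h x by linarith
    have "\<phi> (x + h) - \<phi> x + h * \<psi> x =
      (\<integral>\<omega>. exp (- ((x + h) / W \<omega>)) - exp (- (x / W \<omega>)) + h * (exp (- (x / W \<omega>)) / W \<omega>) \<partial>M)"
      unfolding \<phi>_def \<psi>_def using integrable_\<phi>[OF xh] integrable_\<phi>[of x] integrable_\<psi>[OF x] x
      by (simp del: times_divide_eq_right)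
    also have "\<bar>\<dots>\<bar> \<le> (8 / x\<^sup>2 * h\<^sup>2) * measure M (space M)"
    proof (rule M.integral_bounded)
      fix \<omega> assume \<omega>: "\<omega> \<in> space M"
      define v where "v = 1 / W \<omega>"
      have v: "0 < v" using W_pos[OF \<omega>] by (simp add: v_def)
      have "exp (- ((x + h) / W \<omega>)) - exp (- (x / W \<omega>)) + h * (exp (- (x / W \<omega>)) / W \<omega>) =
        exp (- (x * v)) * (exp (- (h * v)) - 1 - (- (h * v)))"
        by (simp add: v_def algebra_simps add_divide_distrib exp_add[symmetric])
      also have "\<bar>\<dots>\<bar> = exp (- (x * v)) * \<bar>exp (- (h * v)) - 1 - (- (h * v))\<bar>" by (simp add: abs_mult)
      also have "\<dots> \<le> exp (- (x * v)) * ((- (h * v))\<^sup>2 * exp \<bar>- (h * v)\<bar>)"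
        by (intro mult_left_mono exp_second_order_bound) auto
      also have "\<dots> \<le> exp (- (x * v)) * ((h * v)\<^sup>2 * exp (x / 2 * v))"
      proof (intro mult_left_mono)
        have "\<bar>h\<bar> * v \<le> x / 2 * v" using h v by (intro mult_right_mono) auto
        then show "(- (h * v))\<^sup>2 * exp \<bar>- (h * v)\<bar> \<le> (h * v)\<^sup>2 * exp (x / 2 * v)"
          using v by (simp add: abs_mult mult_left_mono)
      qed auto
      also have "\<dots> = h\<^sup>2 * (v\<^sup>2 * (exp (- (x * v)) * exp (x / 2 * v)))" by (simp add: power_mult_distrib)
      also have "exp (- (x * v)) * exp (x / 2 * v) = exp (- (x / 2 * v))"
        by (simp add: exp_add[symmetric])
      also have "h\<^sup>2 * (v\<^sup>2 * exp (- (x / 2 * v))) \<le> h\<^sup>2 * (2 / (x / 2)\<^sup>2)"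
        using x v by (intro mult_left_mono exp_neg_mult_bounds) auto
      finally show "\<bar>exp (- ((x + h) / W \<omega>)) - exp (- (x / W \<omega>)) + h * (exp (- (x / W \<omega>)) / W \<omega>)\<bar> \<le> 8 / x\<^sup>2 * h\<^sup>2"
        by (simp add: power_divide mult.commute)
    qed measurable
    finally show ?thesis by (simp add: B_def mult_ac)
  qed
  have "((\<lambda>h. (\<phi> (x + h) - \<phi> x) / h - (- \<psi> x)) \<longlongrightarrow> 0) (at 0)"
  proof (rule Lim_null_comparison)
    have "eventually (\<lambda>h. \<bar>h\<bar> \<le> x / 2 \<and> h \<noteq> 0) (at (0::real))"
      unfolding eventually_at using x by (intro exI[of _ "x / 2"]) auto
    then show "eventually (\<lambda>h. norm ((\<phi> (x + h) - \<phi> x) / h - (- \<psi> x)) \<le> B * \<bar>h\<bar>) (at 0)"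
    proof eventually_elim
      case (elim h)
      then have "(\<phi> (x + h) - \<phi> x) / h - (- \<psi> x) = (\<phi> (x + h) - \<phi> x + h * \<psi> x) / h"
        by (simp add: field_simps)
      also have "\<bar>\<dots>\<bar> \<le> B * h\<^sup>2 / \<bar>h\<bar>"
        unfolding abs_divide using est[of h] elim by (intro divide_right_mono) auto
      also have "\<dots> = B * \<bar>h\<bar>" using elim by (simp add: power2_eq_square abs_if)
      finally show ?case by simp
    qed
    show "((\<lambda>h. B * \<bar>h\<bar>) \<longlongrightarrow> 0) (at 0)" by (auto intro!: tendsto_eq_intros)
  qed
  then show ?thesis unfolding DERIV_def by (subst (asm) LIM_zero_iff)
qed

lemma monomial_identity:
  "(\<integral>\<omega>. W \<omega> * (1 - W \<omega>) * W \<omega> ^ i \<partial>M) =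
   (\<integral>y. (\<integral>\<omega>. W \<omega> ^ Suc i / Suc i - (W \<omega> * exp (- Y y)) ^ Suc i / Suc i \<partial>M) \<partial>K)"
proof -
  have int: "integrable M (\<lambda>\<omega>. W \<omega> ^ s)" for s
    using W_pos W_le_1 by (intro M.integrable_bounded[of _ 1]) (auto simp: power_le_one less_imp_le power_abs)
  have "(\<integral>\<omega>. W \<omega> * (1 - W \<omega>) * W \<omega> ^ i \<partial>M) = (\<integral>\<omega>. W \<omega> ^ Suc i - W \<omega> ^ Suc (Suc i) \<partial>M)"
    by (intro Bochner_Integration.integral_cong) (auto simp: algebra_simps)
  also have "\<dots> = (\<integral>\<omega>. W \<omega> ^ Suc i \<partial>M) - (\<integral>\<omega>. W \<omega> ^ Suc (Suc i) \<partial>M)"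
    by (intro Bochner_Integration.integral_diff int)
  also have "\<dots> = (\<integral>\<omega>. W \<omega> ^ Suc i \<partial>M) * (\<integral>y. 1 - exp (- (real (Suc i) * Y y)) \<partial>K) / Suc i"
    using recursion[of "Suc i"] by (simp add: field_simps del: power_Suc of_nat_Suc)
  also have "\<dots> = (\<integral>y. (\<integral>\<omega>. W \<omega> ^ Suc i \<partial>M) / Suc i * (1 - exp (- (real (Suc i) * Y y))) \<partial>K)"
    by (simp del: power_Suc of_nat_Suc)
  also have "\<dots> = (\<integral>y. (\<integral>\<omega>. W \<omega> ^ Suc i / Suc i - (W \<omega> * exp (- Y y)) ^ Suc i / Suc i \<partial>M) \<partial>K)"
  proof (intro Bochner_Integration.integral_cong refl)
    fix y
    have "exp (- Y y) ^ Suc i = exp (- (real (Suc i) * Y y))"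
      using exp_of_nat_mult[of "Suc i" "- Y y"] by (simp only: mult_minus_right)
    then have "W \<omega> ^ Suc i / Suc i - (W \<omega> * exp (- Y y)) ^ Suc i / Suc i =
       W \<omega> ^ Suc i * ((1 - exp (- (real (Suc i) * Y y))) / Suc i)" for \<omega>
      by (simp add: power_mult_distrib right_diff_distrib diff_divide_distrib del: power_Suc of_nat_Suc)
    then have "(\<integral>\<omega>. W \<omega> ^ Suc i / Suc i - (W \<omega> * exp (- Y y)) ^ Suc i / Suc i \<partial>M) =
       (\<integral>\<omega>. W \<omega> ^ Suc i \<partial>M) * ((1 - exp (- (real (Suc i) * Y y))) / Suc i)"
      using int by (simp del: power_Suc of_nat_Suc)
    then show "(\<integral>\<omega>. W \<omega> ^ Suc i \<partial>M) / Suc i * (1 - exp (- (real (Suc i) * Y y))) =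
      (\<integral>\<omega>. W \<omega> ^ Suc i / Suc i - (W \<omega> * exp (- Y y)) ^ Suc i / Suc i \<partial>M)" by simp
  qed
  finally show ?thesis .
qed

lemma increment_integrable:
  fixes Q :: "real \<Rightarrow> real"
  assumes Q [measurable]: "Q \<in> borel_measurable borel"
    and B: "\<And>u v. 0 < v \<Longrightarrow> v \<le> u \<Longrightarrow> u \<le> 1 \<Longrightarrow> \<bar>Q u - Q v\<bar> \<le> B"
  shows "y \<in> space K \<Longrightarrow> integrable M (\<lambda>\<omega>. Q (W \<omega>) - Q (W \<omega> * exp (- Y y)))"
    and "integrable K (\<lambda>y. \<integral>\<omega>. Q (W \<omega>) - Q (W \<omega> * exp (- Y y)) \<partial>M)"
    and "\<bar>\<integral>y. (\<integral>\<omega>. Q (W \<omega>) - Q (W \<omega> * exp (- Y y)) \<partial>M) \<partial>K\<bar> \<le> B * measure M (space M) * mass"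
proof -
  have b: "\<bar>Q (W \<omega>) - Q (W \<omega> * exp (- Y y))\<bar> \<le> B" if "y \<in> space K" "\<omega> \<in> space M" for y \<omega>
  proof (rule B)
    show "W \<omega> * exp (- Y y) \<le> W \<omega>"
      using W_pos[OF that(2)] Y_nonneg[OF that(1)] by (intro mult_left_le) auto
  qed (use W_pos W_le_1 that in auto)
  show "y \<in> space K \<Longrightarrow> integrable M (\<lambda>\<omega>. Q (W \<omega>) - Q (W \<omega> * exp (- Y y)))"
    by (rule M.integrable_bounded[of _ B]) (auto intro: b)
  have meas: "(\<lambda>y. \<integral>\<omega>. Q (W \<omega>) - Q (W \<omega> * exp (- Y y)) \<partial>M) \<in> borel_measurable K"
    by measurable
  have b': "\<bar>\<integral>\<omega>. Q (W \<omega>) - Q (W \<omega> * exp (- Y y)) \<partial>M\<bar> \<le> B * measure M (space M)" if "y \<in> space K" for y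
    by (rule M.integral_bounded) (auto intro: b that)
  show "integrable K (\<lambda>y. \<integral>\<omega>. Q (W \<omega>) - Q (W \<omega> * exp (- Y y)) \<partial>M)"
    by (rule integrable_bounded[OF meas b'])
  show "\<bar>\<integral>y. (\<integral>\<omega>. Q (W \<omega>) - Q (W \<omega> * exp (- Y y)) \<partial>M) \<partial>K\<bar> \<le> B * measure M (space M) * mass"
    unfolding mass_def by (rule integral_bounded[OF meas b'])
qed

lemma W_integrable:
  fixes q :: "real \<Rightarrow> real"
  assumes [measurable]: "q \<in> borel_measurable borel" and B: "\<And>u. 0 < u \<Longrightarrow> u \<le> 1 \<Longrightarrow> \<bar>q u\<bar> \<le> B"
  shows "integrable M (\<lambda>\<omega>. W \<omega> * (1 - W \<omega>) * q (W \<omega>))"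
    and "\<bar>\<integral>\<omega>. W \<omega> * (1 - W \<omega>) * q (W \<omega>) \<partial>M\<bar> \<le> B * measure M (space M)"
proof -
  have b: "\<bar>W \<omega> * (1 - W \<omega>) * q (W \<omega>)\<bar> \<le> B" if "\<omega> \<in> space M" for \<omega>
  proof -
    have "\<bar>W \<omega> * (1 - W \<omega>) * q (W \<omega>)\<bar> \<le> 1 * 1 * B"
      unfolding abs_mult using W_pos[OF that] W_le_1[OF that] B[of "W \<omega>"]
      by (intro mult_mono) auto
    then show ?thesis by simp
  qed
  show "integrable M (\<lambda>\<omega>. W \<omega> * (1 - W \<omega>) * q (W \<omega>))"
    by (rule M.integrable_bounded[OF _ b]) measurable
  show "\<bar>\<integral>\<omega>. W \<omega> * (1 - W \<omega>) * q (W \<omega>) \<partial>M\<bar> \<le> B * measure M (space M)"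
    by (rule M.integral_bounded[OF _ b]) measurable
qed

lemma polynomial_identity:
  fixes a :: "nat \<Rightarrow> real" and n :: nat
  defines "q \<equiv> \<lambda>w. \<Sum>i\<le>n. a i * w ^ i" and "Q \<equiv> \<lambda>w. \<Sum>i\<le>n. a i * (w ^ Suc i / Suc i)"
  shows "(\<integral>\<omega>. W \<omega> * (1 - W \<omega>) * q (W \<omega>) \<partial>M) =
   (\<integral>y. (\<integral>\<omega>. Q (W \<omega>) - Q (W \<omega> * exp (- Y y)) \<partial>M) \<partial>K)"
proof -
  define R where "R i w = w ^ Suc i / real (Suc i)" for i :: nat and w :: real
  have R_meas [measurable]: "R i \<in> borel_measurable borel" for i unfolding R_def[abs_def] by measurable
  have R_01: "0 \<le> R i w \<and> R i w \<le> 1" if "0 < w" "w \<le> 1" for i w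
    using that power_le_one[of w "Suc i"] unfolding R_def by (auto simp: divide_simps simp del: power_Suc)
  have R_bound: "\<bar>R i u - R i v\<bar> \<le> 1" if "0 < v" "v \<le> u" "u \<le> 1" for i u v
    using R_01[of u i] R_01[of v i] that by auto
  have R_int1: "integrable M (\<lambda>\<omega>. R i (W \<omega>) - R i (W \<omega> * exp (- Y y)))" if "y \<in> space K" for i y
    by (rule increment_integrable(1)[OF R_meas _ that]) (rule R_bound)
  have R_int2: "integrable K (\<lambda>y. \<integral>\<omega>. R i (W \<omega>) - R i (W \<omega> * exp (- Y y)) \<partial>M)" for i
    by (rule increment_integrable(2)[OF R_meas]) (rule R_bound)
  have "(\<integral>\<omega>. W \<omega> * (1 - W \<omega>) * q (W \<omega>) \<partial>M) =
     (\<integral>\<omega>. (\<Sum>i\<le>n. a i * (W \<omega> * (1 - W \<omega>) * W \<omega> ^ i)) \<partial>M)"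
    unfolding q_def by (simp add: sum_distrib_left mult_ac)
  also have "\<dots> = (\<Sum>i\<le>n. a i * (\<integral>\<omega>. W \<omega> * (1 - W \<omega>) * W \<omega> ^ i \<partial>M))"
    by (subst Bochner_Integration.integral_sum)
       (auto intro!: Bochner_Integration.integrable_mult_right W_integrable[where B = 1]
         simp: power_le_one power_abs[symmetric])
  also have "\<dots> = (\<Sum>i\<le>n. a i * (\<integral>y. (\<integral>\<omega>. R i (W \<omega>) - R i (W \<omega> * exp (- Y y)) \<partial>M) \<partial>K))"
    unfolding R_def by (simp only: monomial_identity)
  also have "\<dots> = (\<integral>y. (\<Sum>i\<le>n. a i * (\<integral>\<omega>. R i (W \<omega>) - R i (W \<omega> * exp (- Y y)) \<partial>M)) \<partial>K)"
    by (subst Bochner_Integration.integral_sum)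
       (simp_all add: R_int2 del: Bochner_Integration.integral_diff)
  also have "\<dots> = (\<integral>y. (\<integral>\<omega>. Q (W \<omega>) - Q (W \<omega> * exp (- Y y)) \<partial>M) \<partial>K)"
  proof (intro Bochner_Integration.integral_cong refl)
    fix y assume y: "y \<in> space K"
    have "(\<Sum>i\<le>n. a i * (\<integral>\<omega>. R i (W \<omega>) - R i (W \<omega> * exp (- Y y)) \<partial>M)) =
      (\<integral>\<omega>. (\<Sum>i\<le>n. a i * (R i (W \<omega>) - R i (W \<omega> * exp (- Y y)))) \<partial>M)"
      by (subst Bochner_Integration.integral_sum)
         (simp_all add: R_int1[OF y] del: Bochner_Integration.integral_diff)
    also have "\<dots> = (\<integral>\<omega>. Q (W \<omega>) - Q (W \<omega> * exp (- Y y)) \<partial>M)"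
      unfolding Q_def R_def by (simp only: sum_subtractf[symmetric] right_diff_distrib)
    finally show "(\<Sum>i\<le>n. a i * (\<integral>\<omega>. R i (W \<omega>) - R i (W \<omega> * exp (- Y y)) \<partial>M)) =
      (\<integral>\<omega>. Q (W \<omega>) - Q (W \<omega> * exp (- Y y)) \<partial>M)" .
  qed
  finally show ?thesis .
qed

text \<open>
  Both sides depend on \<open>G\<close> only through its increments and are therefore continuous with respect to the
  sup norm of the derivative \<open>g\<close>, which is approximated by polynomials.
\<close>

lemma generator_identity:
  fixes G g :: "real \<Rightarrow> real"
  assumes G_meas [measurable]: "G \<in> borel_measurable borel" and g_meas [measurable]: "g \<in> borel_measurable borel"
    and g_cont: "continuous_on {0..1} g"
    and deriv: "\<And>w. 0 < w \<Longrightarrow> w \<le> 1 \<Longrightarrow> (G has_real_derivative g w) (at w)"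
  shows "(\<integral>\<omega>. W \<omega> * (1 - W \<omega>) * g (W \<omega>) \<partial>M) =
   (\<integral>y. (\<integral>\<omega>. G (W \<omega>) - G (W \<omega> * exp (- Y y)) \<partial>M) \<partial>K)" (is "?L g = ?J G")
proof -
  have lipschitz: "\<bar>F u - F v\<bar> \<le> B"
    if "\<And>w. 0 < w \<Longrightarrow> w \<le> 1 \<Longrightarrow> (F has_real_derivative f w) (at w)" "\<And>w. 0 < w \<Longrightarrow> w \<le> 1 \<Longrightarrow> \<bar>f w\<bar> \<le> B"
      "0 < v" "v \<le> u" "u \<le> 1" for F f :: "real \<Rightarrow> real" and u v B
  proof (cases "u = v")
    case True
    have "0 \<le> \<bar>f u\<bar>" "\<bar>f u\<bar> \<le> B" using that(2)[of u] that(3-5) by auto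
    then show ?thesis using True by simp
  next
    case False
    then have "\<exists>z>v. z < u \<and> F u - F v = (u - v) * f z"
      using that(3-5) by (intro MVT2 that(1)) auto
    then obtain z where z: "v < z" "z < u" "F u - F v = (u - v) * f z" by blast
    then have "\<bar>F u - F v\<bar> \<le> 1 * B"
      unfolding z(3) abs_mult using that(2)[of z] that(3-5) by (intro mult_mono) auto
    then show ?thesis by simp
  qed
  have "compact (g ` {0..1})" by (intro compact_continuous_image g_cont) simp
  then have "bounded (g ` {0..1})" by (rule compact_imp_bounded)
  then obtain B where B: "\<And>w. w \<in> {0..1} \<Longrightarrow> \<bar>g w\<bar> \<le> B"
    unfolding bounded_iff real_norm_def by (metis imageI)
  have G_bound: "\<bar>G u - G v\<bar> \<le> B" if "0 < v" "v \<le> u" "u \<le> 1" for u v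
    by (rule lipschitz[OF deriv _ that]) (auto intro: B)
  have "\<bar>?L g - ?J G\<bar> \<le> e" if "e > 0" for e
  proof -
    define e' where "e' = e / (measure M (space M) * (1 + mass))"
    have e': "e' > 0" using that M_pos mass_nonneg by (simp add: e'_def)
    obtain q where q: "real_polynomial_function q" "\<And>w. w \<in> {0..1} \<Longrightarrow> \<bar>g w - q w\<bar> < e'"
      using Stone_Weierstrass_real_polynomial_function[OF _ g_cont e'] by auto
    from q(1) obtain a n where q_eq: "q = (\<lambda>w. \<Sum>i\<le>n. a i * w ^ i)"
      by (auto simp: real_polynomial_function_iff_sum)
    define Q where "Q = (\<lambda>w::real. \<Sum>i\<le>n. a i * (w ^ Suc i / Suc i))"
    have q_meas [measurable]: "q \<in> borel_measurable borel" unfolding q_eq by measurable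
    have Q_meas [measurable]: "Q \<in> borel_measurable borel" unfolding Q_def by measurable
    have Q_deriv: "(Q has_real_derivative q w) (at w)" for w
    proof -
      have "((\<lambda>w. w ^ Suc i / Suc i) has_real_derivative w ^ i) (at w)" for i
        by (rule derivative_eq_intros refl | simp add: field_simps del: of_nat_Suc)+
      then show ?thesis unfolding Q_def q_eq by (intro DERIV_sum DERIV_cmult)
    qed
    have q_cont: "continuous_on {0..1} q" unfolding q_eq by (intro continuous_intros)
    have "compact (q ` {0..1})" by (intro compact_continuous_image q_cont) simp
    then have "bounded (q ` {0..1})" by (rule compact_imp_bounded)
    then obtain B' where B': "\<And>w. w \<in> {0..1} \<Longrightarrow> \<bar>q w\<bar> \<le> B'"
      unfolding bounded_iff real_norm_def by (metis imageI)
    have Q_bound: "\<bar>Q u - Q v\<bar> \<le> B'" if "0 < v" "v \<le> u" "u \<le> 1" for u v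
      by (rule lipschitz[OF Q_deriv _ that]) (auto intro: B')
    have GQ_bound: "\<bar>(G u - Q u) - (G v - Q v)\<bar> \<le> e'" if "0 < v" "v \<le> u" "u \<le> 1" for u v
      by (rule lipschitz[OF DERIV_diff[OF deriv Q_deriv] _ that]) (auto intro!: less_imp_le[OF q(2)])
    have "?L g - ?L q = (\<integral>\<omega>. W \<omega> * (1 - W \<omega>) * (g (W \<omega>) - q (W \<omega>)) \<partial>M)"
      using W_integrable(1)[OF g_meas, of B] W_integrable(1)[OF q_meas, of B'] B B'
      by (simp add: right_diff_distrib)
    also have "\<bar>\<dots>\<bar> \<le> e' * measure M (space M)"
      by (rule W_integrable(2)[of "\<lambda>w. g w - q w"]) (auto intro!: less_imp_le[OF q(2)])
    finally have 1: "\<bar>?L g - ?L q\<bar> \<le> e' * measure M (space M)" .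
    have "?J G - ?J Q = (\<integral>y. (\<integral>\<omega>. G (W \<omega>) - G (W \<omega> * exp (- Y y)) \<partial>M) - (\<integral>\<omega>. Q (W \<omega>) - Q (W \<omega> * exp (- Y y)) \<partial>M) \<partial>K)"
      by (rule Bochner_Integration.integral_diff[symmetric])
         (rule increment_integrable(2)[OF G_meas], erule (2) G_bound,
          rule increment_integrable(2)[OF Q_meas], erule (2) Q_bound)
    also have "\<dots> = (\<integral>y. (\<integral>\<omega>. (G (W \<omega>) - Q (W \<omega>)) - (G (W \<omega> * exp (- Y y)) - Q (W \<omega> * exp (- Y y))) \<partial>M) \<partial>K)"
    proof (rule Bochner_Integration.integral_cong[OF refl])
      fix y assume y: "y \<in> space K"
      have "(\<integral>\<omega>. G (W \<omega>) - G (W \<omega> * exp (- Y y)) \<partial>M) - (\<integral>\<omega>. Q (W \<omega>) - Q (W \<omega> * exp (- Y y)) \<partial>M) =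
        (\<integral>\<omega>. (G (W \<omega>) - G (W \<omega> * exp (- Y y))) - (Q (W \<omega>) - Q (W \<omega> * exp (- Y y))) \<partial>M)"
        by (rule Bochner_Integration.integral_diff[symmetric])
          (rule increment_integrable(1)[OF G_meas _ y], erule (2) G_bound,
           rule increment_integrable(1)[OF Q_meas _ y], erule (2) Q_bound)
      also have "\<dots> = (\<integral>\<omega>. (G (W \<omega>) - Q (W \<omega>)) - (G (W \<omega> * exp (- Y y)) - Q (W \<omega> * exp (- Y y))) \<partial>M)"
        by (intro Bochner_Integration.integral_cong refl) simp
      finally show "(\<integral>\<omega>. G (W \<omega>) - G (W \<omega> * exp (- Y y)) \<partial>M) - (\<integral>\<omega>. Q (W \<omega>) - Q (W \<omega> * exp (- Y y)) \<partial>M) =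
        (\<integral>\<omega>. (G (W \<omega>) - Q (W \<omega>)) - (G (W \<omega> * exp (- Y y)) - Q (W \<omega> * exp (- Y y))) \<partial>M)" .
    qed
    also have "\<bar>\<dots>\<bar> \<le> e' * measure M (space M) * mass"
      by (rule increment_integrable(3)[of "\<lambda>w. G w - Q w", OF _ GQ_bound]) measurable
    finally have 2: "\<bar>?J G - ?J Q\<bar> \<le> e' * measure M (space M) * mass" .
    have "?L q = ?J Q" unfolding q_eq Q_def by (rule polynomial_identity)
    with 1 2 have "\<bar>?L g - ?J G\<bar> \<le> e' * measure M (space M) + e' * measure M (space M) * mass" by linarith
    also have "\<dots> = e' * (measure M (space M) * (1 + mass))" by (simp add: algebra_simps)
    also have "\<dots> = e" using M_pos mass_nonneg by (simp add: e'_def)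
    finally show ?thesis .
  qed
  then show ?thesis using field_le_epsilon[of "\<bar>?L g - ?J G\<bar>" 0] by auto
qed

end

context moment_recursion
begin

lemma \<phi>_measurable [measurable]: "\<phi> \<in> borel_measurable borel"
  unfolding \<phi>_def[abs_def] by measurable

lemma dilated_\<phi>_integrable:
  assumes "0 < x"
  shows "integrable K (\<lambda>y. \<phi> (x * exp (Y y)))"
proof (rule integrable_bounded)
  fix y assume "y \<in> space K"
  then have "x \<le> x * exp (Y y)" using assms Y_nonneg by simp
  then show "\<bar>\<phi> (x * exp (Y y))\<bar> \<le> \<phi> x"
    using \<phi>_antimono[of x "x * exp (Y y)"] \<phi>_pos[of "x * exp (Y y)"] assms by simp
qed measurable

text \<open>
  The case \<open>G w = exp (- (x / w))\<close> of the preceding identity. Its derivative extends continuously by \<open>0\<close>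
  to \<open>w = 0\<close>, which agrees with the value given by the convention \<open>x / 0 = 0\<close>.
\<close>

lemma \<phi>_equation:
  assumes x: "0 < x"
  shows "x * (\<psi> x - \<phi> x) = mass * \<phi> x - (\<integral>y. \<phi> (x * exp (Y y)) \<partial>K)"
proof -
  define G where "G w = exp (- (x / w))" for w
  define g where "g w = x / w\<^sup>2 * exp (- (x / w))" for w
  have "(\<integral>\<omega>. W \<omega> * (1 - W \<omega>) * g (W \<omega>) \<partial>M) =
   (\<integral>y. (\<integral>\<omega>. G (W \<omega>) - G (W \<omega> * exp (- Y y)) \<partial>M) \<partial>K)"
  proof (rule generator_identity)
    show "G \<in> borel_measurable borel" unfolding G_def[abs_def] by measurable
    show "g \<in> borel_measurable borel" unfolding g_def[abs_def] by measurable
    show "(G has_real_derivative g w) (at w)" if "0 < w" for w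
      unfolding G_def g_def using that
      by (auto intro!: derivative_eq_intros simp: power2_eq_square)
    show "continuous_on {0..1} g"
      unfolding continuous_on_def
    proof
      fix w :: real assume w: "w \<in> {0..1}"
      show "(g \<longlongrightarrow> g w) (at w within {0..1})"
      proof (cases "w = 0")
        case True
        have "(g \<longlongrightarrow> 0) (at_right 0)" unfolding g_def[abs_def] using x by real_asymp
        then show ?thesis using True at_within_Icc_at_right[of 0 "1::real"] by (simp add: g_def)
      next
        case False
        then have "isCont g w" unfolding g_def[abs_def] by (intro continuous_intros) auto
        then show ?thesis by (simp add: isCont_def tendsto_within_subset[of _ _ _ UNIV])
      qed
    qed
  qed
  also have "(\<integral>\<omega>. W \<omega> * (1 - W \<omega>) * g (W \<omega>) \<partial>M) = (\<integral>\<omega>. x * (exp (- (x / W \<omega>)) / W \<omega> - exp (- (x / W \<omega>))) \<partial>M)"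
  proof (rule Bochner_Integration.integral_cong[OF refl])
    fix \<omega> assume "\<omega> \<in> space M"
    then have "W \<omega> \<noteq> 0" using W_pos[of \<omega>] by simp
    then show "W \<omega> * (1 - W \<omega>) * g (W \<omega>) = x * (exp (- (x / W \<omega>)) / W \<omega> - exp (- (x / W \<omega>)))"
      unfolding g_def by (simp add: field_simps power2_eq_square)
  qed
  also have "\<dots> = x * (\<psi> x - \<phi> x)"
    unfolding \<phi>_def \<psi>_def using integrable_\<phi>[of x] integrable_\<psi>[OF x] x by simp
  also have "(\<integral>y. (\<integral>\<omega>. G (W \<omega>) - G (W \<omega> * exp (- Y y)) \<partial>M) \<partial>K) = (\<integral>y. \<phi> x - \<phi> (x * exp (Y y)) \<partial>K)"
  proof (rule Bochner_Integration.integral_cong[OF refl])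
    fix y
    have "G (W \<omega> * exp (- Y y)) = exp (- (x * exp (Y y) / W \<omega>))" for \<omega>
      by (simp add: G_def exp_minus field_simps)
    then show "(\<integral>\<omega>. G (W \<omega>) - G (W \<omega> * exp (- Y y)) \<partial>M) = \<phi> x - \<phi> (x * exp (Y y))"
      unfolding \<phi>_def G_def using integrable_\<phi>[of x] integrable_\<phi>[of "x * exp (Y y)"] x by simp
  qed
  also have "\<dots> = mass * \<phi> x - (\<integral>y. \<phi> (x * exp (Y y)) \<partial>K)"
    using dilated_\<phi>_integrable[OF x] by (simp add: mass_def)
  finally show ?thesis .
qed

definition "g x = (\<integral>y. \<phi> (x * exp (Y y)) \<partial>K) / \<phi> x"

lemma g_orbit_has_integral:
  assumes x: "0 < x" and y: "0 \<le> y"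
  shows "((\<lambda>z. g (x * exp z)) has_integral x * (exp y - 1) + mass * y + ln (\<phi> (x * exp y)) - ln (\<phi> x)) {0..y}"
proof -
  let ?F = "\<lambda>z. x * exp z + mass * z + ln (\<phi> (x * exp z))"
  have "((\<lambda>z. g (x * exp z)) has_integral ?F y - ?F 0) {0..y}"
  proof (rule fundamental_theorem_of_calculus[OF y])
    fix z
    have pos: "0 < x * exp z" "0 < \<phi> (x * exp z)" using x \<phi>_pos[of "x * exp z"] by auto
    have "((\<lambda>z. \<phi> (x * exp z)) has_real_derivative - \<psi> (x * exp z) * (x * exp z)) (at z)"
    proof (rule DERIV_chain2[where f = \<phi> and g = "\<lambda>z. x * exp z"])
      show "((\<lambda>z. x * exp z) has_real_derivative x * exp z) (at z)"
        by (auto intro!: derivative_eq_intros)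
    qed (rule \<phi>_deriv[OF pos(1)])
    then have "(?F has_real_derivative x * exp z + mass + - \<psi> (x * exp z) * (x * exp z) / \<phi> (x * exp z)) (at z)"
      using pos(2) by (auto intro!: derivative_eq_intros)
    also have "x * exp z + mass + - \<psi> (x * exp z) * (x * exp z) / \<phi> (x * exp z) = g (x * exp z)"
      using \<phi>_equation[OF pos(1)] pos(2) unfolding g_def by (simp add: field_simps)
    finally show "(?F has_vector_derivative g (x * exp z)) (at z within {0..y})"
      unfolding has_real_derivative_iff_has_vector_derivative by (rule has_vector_derivative_at_within)
  qed
  then show ?thesis by (simp add: algebra_simps)
qed

lemma g_admissible: "admissible g"
  unfolding admissible_def
proof (intro allI impI conjI)
  fix x y :: real assume x: "0 < x"
  have "0 \<le> (\<integral>y. \<phi> (x * exp (Y y)) \<partial>K)"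
    using \<phi>_pos x by (intro Bochner_Integration.integral_nonneg less_imp_le) auto
  then show "0 \<le> g x" unfolding g_def using \<phi>_pos[of x] x by (intro divide_nonneg_pos) auto
  have "(\<integral>y. \<phi> (x * exp (Y y)) \<partial>K) \<le> (\<integral>y. \<phi> x \<partial>K)"
    using x Y_nonneg by (intro integral_mono dilated_\<phi>_integrable \<phi>_antimono) auto
  then show "g x \<le> mass"
    unfolding g_def using \<phi>_pos[of x] x by (simp add: divide_le_eq mass_def)
  show "(\<lambda>z. g (x * exp z)) integrable_on {0..y}"
    using g_orbit_has_integral[OF x, of y] by (cases "0 \<le> y") (auto simp: integrable_on_def)
qed

lemma kern_g:
  assumes "0 < x" "0 \<le> y"
  shows "kern g x y = \<phi> (x * exp y) / \<phi> x"
  using integral_unique[OF g_orbit_has_integral[OF assms]] \<phi>_pos[of x] \<phi>_pos[of "x * exp y"] assms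
  by (simp add: kern_def exp_diff)

theorem \<phi>_ratio_cm:
  assumes c: "0 < c" "c < 1"
  shows "cm_upto n (\<lambda>x. \<phi> x / \<phi> (c * x))"
proof -
  have "cm_upto n g" for n
  proof (rule fixed_point_cm[OF g_admissible])
    fix x :: real assume x: "0 < x"
    have "jump_op g x = (\<integral>y. \<phi> (x * exp (Y y)) / \<phi> x \<partial>K)"
      unfolding jump_op_def
      by (rule Bochner_Integration.integral_cong) (simp_all add: kern_g[OF x] Y_nonneg)
    then show "jump_op g x = g x" by (simp add: g_def)
  qed
  then have "cm_upto n (\<lambda>x. kern g x (- ln c))"
    using c by (intro kern_cm) auto
  then have "cm_upto n (\<lambda>x. kern g (c * x) (- ln c))"
    by (rule cm_upto_dilate[OF c(1)])
  moreover have "kern g (c * x) (- ln c) = \<phi> x / \<phi> (c * x)" if "0 < x" for x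
  proof -
    have "c * x * exp (- ln c) = x" using c by (simp add: exp_minus)
    moreover have "kern g (c * x) (- ln c) = \<phi> (c * x * exp (- ln c)) / \<phi> (c * x)"
      using c that by (intro kern_g) auto
    ultimately show ?thesis by (simp only:)
  qed
  ultimately show ?thesis by (simp cong: cm_upto_cong)
qed

end

section \<open>Partial fractions and Beta integrals\<close>

text \<open>
  All residues of the rational function on the left are given explicitly. In the induction step the new
  residue is the value of the previous product at the new pole.
\<close>

lemma partial_fractions_shift:
  fixes b :: "'i \<Rightarrow> real"
  assumes "finite I" "inj_on b I" "\<And>i. i \<in> I \<Longrightarrow> s + b i \<noteq> 0"
  shows "(\<Prod>i\<in>I. (s + b i - 1) / (s + b i)) =
    1 - (\<Sum>i\<in>I. (\<Prod>l\<in>I - {i}. (b l - b i - 1) / (b l - b i)) / (s + b i))"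
  using assms
proof (induction I arbitrary: s rule: finite_induct)
  case (insert m I)
  define A where "A i = (\<Prod>l\<in>I - {i}. (b l - b i - 1) / (b l - b i))" for i
  have ne: "b m - b i \<noteq> 0" if "i \<in> I" for i
    using that insert by (auto simp: inj_on_def)
  have IH: "(\<Prod>i\<in>I. (x + b i - 1) / (x + b i)) = 1 - (\<Sum>i\<in>I. A i / (x + b i))"
    if "\<And>i. i \<in> I \<Longrightarrow> x + b i \<noteq> 0" for x
    unfolding A_def by (rule insert.IH) (use insert.prems that in auto)
  have Am: "(\<Prod>l\<in>insert m I - {m}. (b l - b m - 1) / (b l - b m)) = 1 + (\<Sum>i\<in>I. A i / (b m - b i))"
  proof -
    have "insert m I - {m} = I" using insert.hyps by auto
    then have "(\<Prod>l\<in>insert m I - {m}. (b l - b m - 1) / (b l - b m)) = (\<Prod>i\<in>I. (- b m + b i - 1) / (- b m + b i))"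
      by (simp add: algebra_simps)
    also have "\<dots> = 1 - (\<Sum>i\<in>I. A i / (- b m + b i))" by (rule IH) (use ne in force)
    also have "(\<Sum>i\<in>I. A i / (- b m + b i)) = - (\<Sum>i\<in>I. A i / (b m - b i))"
      unfolding sum_negf[symmetric] by (intro sum.cong refl) (simp add: minus_divide_right)
    finally show ?thesis by simp
  qed
  have Ai: "(\<Prod>l\<in>insert m I - {i}. (b l - b i - 1) / (b l - b i)) = A i * (1 - 1 / (b m - b i))" if "i \<in> I" for i
  proof -
    have "insert m I - {i} = insert m (I - {i})" using that insert.hyps by auto
    then have "(\<Prod>l\<in>insert m I - {i}. (b l - b i - 1) / (b l - b i)) = (b m - b i - 1) / (b m - b i) * A i"
      using insert.hyps by (simp add: A_def)
    then show ?thesis using ne[OF that] by (simp add: field_simps)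
  qed
  have sm: "s + b m \<noteq> 0" and si: "\<And>i. i \<in> I \<Longrightarrow> s + b i \<noteq> 0" using insert.prems by auto
  have split: "A i / (s + b i) * (1 - 1 / (s + b m)) = A i * (1 - 1 / (b m - b i)) / (s + b i) + A i / (b m - b i) / (s + b m)"
    if "i \<in> I" for i
    using ne[OF that] si[OF that] sm by (simp add: divide_simps) (simp add: algebra_simps)
  have "(\<Prod>i\<in>insert m I. (s + b i - 1) / (s + b i)) = (1 - 1 / (s + b m)) * (1 - (\<Sum>i\<in>I. A i / (s + b i)))"
    using insert.hyps IH[OF si] sm by (simp add: diff_divide_distrib)
  also have "\<dots> = 1 - 1 / (s + b m) - (\<Sum>i\<in>I. A i / (s + b i) * (1 - 1 / (s + b m)))"
  proof -
    have "(1 - u) * (1 - S) = 1 - u - S * (1 - u)" for u S :: real by (simp add: algebra_simps)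
    then show ?thesis by (simp only: sum_distrib_right)
  qed
  also have "(\<Sum>i\<in>I. A i / (s + b i) * (1 - 1 / (s + b m))) =
     (\<Sum>i\<in>I. A i * (1 - 1 / (b m - b i)) / (s + b i)) + (\<Sum>i\<in>I. A i / (b m - b i)) / (s + b m)"
    unfolding sum_divide_distrib sum.distrib[symmetric] by (rule sum.cong[OF refl split])
  also have "1 - 1 / (s + b m) - \<dots> = 1 - ((\<Sum>i\<in>I. A i * (1 - 1 / (b m - b i)) / (s + b i)) + (1 + (\<Sum>i\<in>I. A i / (b m - b i))) / (s + b m))"
    by (simp add: add_divide_distrib)
  also have "(1 + (\<Sum>i\<in>I. A i / (b m - b i))) / (s + b m) = (\<Prod>l\<in>insert m I - {m}. (b l - b m - 1) / (b l - b m)) / (s + b m)"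
    by (simp only: Am)
  also have "(\<Sum>i\<in>I. A i * (1 - 1 / (b m - b i)) / (s + b i)) = (\<Sum>i\<in>I. (\<Prod>l\<in>insert m I - {i}. (b l - b i - 1) / (b l - b i)) / (s + b i))"
    by (intro sum.cong refl) (simp only: Ai)
  finally show ?case
    unfolding sum.insert[OF insert.hyps(1,2)] by (simp only: add.commute)
qed simp

text \<open>
  The argument \<open>max 0 y\<close> anticipates that jump sizes have to be nonnegative everywhere, not only almost
  everywhere.
\<close>

lemma exponential_density_Laplace:
  assumes l: "0 < l" and s: "0 \<le> s"
  shows "has_bochner_integral lborel (\<lambda>y. exponential_density l y * exp (- (s * max 0 y))) (l / (s + l))"
proof -
  have "has_bochner_integral lborel (exponential_density (s + l)) 1"
  proof (rule has_bochner_integral_nn_integral)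
    interpret prob_space "density lborel (exponential_density (s + l))"
      using l s by (intro prob_space_exponential_density) auto
    show "(\<integral>\<^sup>+y. ennreal (exponential_density (s + l) y) \<partial>lborel) = ennreal 1"
      using emeasure_space_1 by (simp add: emeasure_density)
  qed (use l s in \<open>auto intro!: AE_I2 exponential_density_nonneg\<close>)
  then have "has_bochner_integral lborel (\<lambda>y. l / (s + l) * exponential_density (s + l) y) (l / (s + l) * 1)"
    by (intro has_bochner_integral_mult_right) auto
  also have "(\<lambda>y. l / (s + l) * exponential_density (s + l) y) = (\<lambda>y. exponential_density l y * exp (- (s * max 0 y)))"
  proof
    fix y
    have "l / (s + l) * (s + l) = l" using l s by simp
    then have "l / (s + l) * ((s + l) * exp (- y * (s + l))) = l * (exp (- y * l) * exp (- (s * y)))"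
      by (simp only: mult.assoc[symmetric] exp_add[symmetric]) (simp add: algebra_simps)
    then show "l / (s + l) * exponential_density (s + l) y = exponential_density l y * exp (- (s * max 0 y))"
      by (simp add: exponential_density_def)
  qed
  finally show ?thesis by simp
qed

lemma Beta_Suc_real:
  assumes "0 < (x :: real)"
  shows "Beta x (real (Suc n)) = fact n / (\<Prod>i\<le>n. x + real i)"
proof -
  have "pochhammer x (Suc n) = Gamma (x + real (Suc n)) / Gamma x"
    by (rule pochhammer_Gamma) (use assms in \<open>auto elim!: nonpos_Ints_cases\<close>)
  then have "Gamma x / Gamma (x + real (Suc n)) = 1 / pochhammer x (Suc n)"
    by (simp only: divide_divide_eq_right mult_1)
  also have "pochhammer x (Suc n) = (\<Prod>i\<le>n. x + real i)"
    unfolding pochhammer_prod atLeast0LessThan lessThan_Suc_atMost ..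
  finally have "Gamma x / Gamma (x + real (Suc n)) = 1 / (\<Prod>i\<le>n. x + real i)" .
  moreover have "Gamma (real (Suc n)) = fact n"
    using Gamma_fact[of n, where 'a = real] by (simp add: add.commute)
  ultimately show ?thesis
    unfolding Beta_def by (metis (no_types) mult.commute times_divide_eq_left mult_1)
qed

lemma beta_kernel_integral:
  fixes p :: real
  assumes p: "0 < p" and n: "0 < n"
  shows "has_bochner_integral lborel
    (\<lambda>x. if 0 < x \<and> x < real n then (x / n) powr (p - 1) * (1 - x / n) ^ n else 0) (real n * Beta p (real (Suc n)))"
proof -
  let ?f = "\<lambda>x. if 0 < x \<and> x < 1 then x powr (p - 1) * (1 - x) ^ n else 0"
  have "((\<lambda>x. x powr (p - 1) * (1 - x) powr (real (Suc n) - 1)) has_integral Beta p (real (Suc n))) {0..1}"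
    by (rule has_integral_Beta_real) (use p in auto)
  then have "((\<lambda>x. x powr (p - 1) * (1 - x) powr (real (Suc n) - 1)) has_integral Beta p (real (Suc n))) {0<..<1}"
    by (simp only: has_integral_Icc_iff_Ioo)
  then have "(?f has_integral Beta p (real (Suc n))) {0<..<1}"
    by (rule has_integral_eq[rotated]) (auto simp: powr_realpow)
  then have I: "(?f has_integral Beta p (real (Suc n))) UNIV"
    by (rule has_integral_on_superset) auto
  have meas [measurable]: "?f \<in> borel_measurable borel" by measurable
  have "has_bochner_integral lborel ?f (Beta p (real (Suc n)))"
  proof (rule has_bochner_integral_nn_integral)
    show "(\<integral>\<^sup>+x. ennreal (?f x) \<partial>lborel) = ennreal (Beta p (real (Suc n)))"
      by (rule nn_integral_has_integral_lborel[OF meas _ I]) simp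
    show "0 \<le> Beta p (real (Suc n))"
      using I by (rule has_integral_nonneg) simp
  qed simp_all
  then have "has_bochner_integral lborel (\<lambda>x. ?f (0 + (1 / real n) * x)) (Beta p (real (Suc n)) /\<^sub>R \<bar>1 / real n\<bar>)"
    using lborel_has_bochner_integral_real_affine_iff[of "1 / real n" ?f "Beta p (real (Suc n))" 0] n
    by (simp only:) auto
  also have "(\<lambda>x. ?f (0 + (1 / real n) * x)) =
    (\<lambda>x. if 0 < x \<and> x < real n then (x / n) powr (p - 1) * (1 - x / n) ^ n else 0)"
    using n by (simp add: fun_eq_iff zero_less_divide_iff pos_divide_less_eq)
  also have "Beta p (real (Suc n)) /\<^sub>R \<bar>1 / real n\<bar> = real n * Beta p (real (Suc n))"
    by simp
  finally show ?thesis .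
qed

section \<open>Beta approximation of the Gamma variable\<close>

text \<open>
  The parameter \<open>t\<close> of the Gamma law and the exponent \<open>a = - \<xi>\<close>.
\<close>

locale gamma_power =
  fixes t a :: real
  assumes t: "0 < t" and a: "0 < a" "a < 1"
begin

text \<open>
  The exponential rates of the jumps, which are minus the poles of
  \<open>Beta (t + a * (s + 1)) (n + 1) / Beta (t + a * s) (n + 1)\<close> as a function of \<open>s\<close>, together with minus the
  residues at these poles.
\<close>

definition "rate i = (t + real i) / a + 1"

definition "weight n i = (\<Prod>l\<in>{..n} - {i}. (rate l - rate i - 1) / (rate l - rate i))"

definition "jump_density n y = (\<Sum>i\<le>n. weight n i * exponential_density (rate i) y)"

definition "beta_density n u = (if 0 < u \<and> u < real n then u powr (t - 1) * (1 - u / real n) ^ n else 0)"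

definition "jump_measure n = density lborel (\<lambda>y. ennreal (jump_density n y))"

definition "beta_measure n = density lborel (\<lambda>u. ennreal (beta_density n u))"

definition "beta_power n u = (if 0 < u \<and> u < real n then (u / real n) powr a else 1)"

lemma rate_pos: "0 < rate i"
  using t a by (simp add: rate_def add_pos_pos)

text \<open>
  Every factor has the form \<open>1 - a / (l - i)\<close> with an integer \<open>l - i \<noteq> 0\<close>, so \<open>a < 1\<close> makes it positive.
\<close>

lemma weight_nonneg: "0 \<le> weight n i"
  unfolding weight_def
proof (rule prod_nonneg)
  fix l assume l: "l \<in> {..n} - {i}"
  have d: "rate l - rate i = (real l - real i) / a"
    by (simp add: rate_def add_divide_distrib diff_divide_distrib)
  have "(rate l - rate i - 1) / (rate l - rate i) = 1 - a / (real l - real i)"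
    unfolding d using l a by (simp add: field_simps)
  also have "0 \<le> \<dots>"
  proof (cases "i < l")
    case True
    then have "a \<le> real l - real i" using a by linarith
    then show ?thesis using True by (simp add: divide_le_eq)
  next
    case False
    then have "real l - real i < 0" using l by auto
    then have "a / (real l - real i) \<le> 0" using a by (intro divide_nonneg_neg) auto
    then show ?thesis by linarith
  qed
  finally show "0 \<le> (rate l - rate i - 1) / (rate l - rate i)" .
qed

lemma jump_density_nonneg: "0 \<le> jump_density n y"
  unfolding jump_density_def
  by (intro sum_nonneg mult_nonneg_nonneg weight_nonneg exponential_density_nonneg rate_pos)

lemma jump_density_measurable [measurable]: "jump_density n \<in> borel_measurable borel"
  unfolding jump_density_def[abs_def] by measurable

lemma beta_density_nonneg: "0 \<le> beta_density n u"
  by (simp add: beta_density_def divide_le_eq)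

lemma beta_density_measurable [measurable]: "beta_density n \<in> borel_measurable borel"
  unfolding beta_density_def[abs_def] by measurable

lemma beta_power_measurable [measurable]: "beta_power n \<in> borel_measurable borel"
  unfolding beta_power_def[abs_def] by measurable

lemma jump_Laplace:
  assumes "0 \<le> s"
  shows "has_bochner_integral lborel (\<lambda>y. jump_density n y * exp (- (s * max 0 y)))
    (\<Sum>i\<le>n. weight n i * (rate i / (s + rate i)))"
proof -
  have "has_bochner_integral lborel (\<lambda>y. \<Sum>i\<le>n. weight n i * (exponential_density (rate i) y * exp (- (s * max 0 y))))
    (\<Sum>i\<le>n. weight n i * (rate i / (s + rate i)))"
    by (intro has_bochner_integral_sum has_bochner_integral_mult_right exponential_density_Laplace rate_pos assms)
  then show ?thesis by (simp add: jump_density_def sum_distrib_right mult.assoc)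
qed

lemma jump_increment_integral:
  assumes "0 \<le> s"
  shows "(\<integral>y. 1 - exp (- (s * max 0 y)) \<partial>jump_measure n) = s * (\<Sum>i\<le>n. weight n i / (s + rate i))"
proof -
  have "(\<integral>y. 1 - exp (- (s * max 0 y)) \<partial>jump_measure n) =
    (\<integral>y. jump_density n y * (1 - exp (- (s * max 0 y))) \<partial>lborel)"
    unfolding jump_measure_def by (subst integral_density) (auto simp: jump_density_nonneg)
  also have "\<dots> = (\<integral>y. jump_density n y * exp (- (0 * max 0 y)) - jump_density n y * exp (- (s * max 0 y)) \<partial>lborel)"
    by (simp add: right_diff_distrib)
  also have "\<dots> = (\<Sum>i\<le>n. weight n i * (rate i / (0 + rate i))) - (\<Sum>i\<le>n. weight n i * (rate i / (s + rate i)))"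
    by (intro has_bochner_integral_integral_eq has_bochner_integral_diff jump_Laplace assms) simp
  also have "\<dots> = (\<Sum>i\<le>n. s * (weight n i / (s + rate i)))"
    unfolding sum_subtractf[symmetric]
  proof (intro sum.cong refl)
    fix i
    have "0 < rate i" "0 < s + rate i" using rate_pos[of i] assms by auto
    then show "weight n i * (rate i / (0 + rate i)) - weight n i * (rate i / (s + rate i)) = s * (weight n i / (s + rate i))"
      by (simp add: field_simps)
  qed
  finally show ?thesis by (simp add: sum_distrib_left)
qed

lemma beta_power_moment:
  assumes n: "0 < n"
  shows "has_bochner_integral lborel (\<lambda>u. beta_density n u * beta_power n u ^ s)
    (real n powr t * Beta (t + a * real s) (real (Suc n)))"
proof -
  have p: "0 < t + a * real s" using t a by (simp add: add_pos_nonneg)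
  have "has_bochner_integral lborel (\<lambda>u. real n powr (t - 1) * (if 0 < u \<and> u < real n then (u / n) powr (t + a * real s - 1) * (1 - u / n) ^ n else 0))
    (real n powr (t - 1) * (real n * Beta (t + a * real s) (real (Suc n))))"
    by (intro has_bochner_integral_mult_right beta_kernel_integral p n)
  also have "(\<lambda>u. real n powr (t - 1) * (if 0 < u \<and> u < real n then (u / n) powr (t + a * real s - 1) * (1 - u / n) ^ n else 0))
    = (\<lambda>u. beta_density n u * beta_power n u ^ s)"
  proof
    fix u
    show "real n powr (t - 1) * (if 0 < u \<and> u < real n then (u / n) powr (t + a * real s - 1) * (1 - u / n) ^ n else 0)
      = beta_density n u * beta_power n u ^ s"
    proof (cases "0 < u \<and> u < real n")
      case True
      have "((u / n) powr a) ^ s = (u / n) powr (a * real s)"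
        using True n by (simp add: powr_powr[symmetric] powr_realpow)
      moreover have "(u / n) powr (t + a * real s - 1) = (u / n) powr (t - 1) * (u / n) powr (a * real s)"
        by (simp add: powr_add[symmetric] algebra_simps)
      moreover have "real n powr (t - 1) * (u / n) powr (t - 1) = u powr (t - 1)"
        using True n by (simp add: powr_mult[symmetric])
      ultimately show ?thesis using True by (simp add: beta_density_def beta_power_def mult_ac)
    next
      case False
      then show ?thesis
        by (simp only: beta_density_def if_False mult_zero_left mult_zero_right)
    qed
  qed
  also have "real n powr (t - 1) * (real n * Beta (t + a * real s) (real (Suc n))) = real n powr t * Beta (t + a * real s) (real (Suc n))"
    using n powr_mult_base[of "real n" "t - 1"] by (simp add: mult_ac)
  finally show ?thesis .
qed

text \<open>
  The quotient of the two Beta functions is a product of \<open>n + 1\<close> linear fractional functions of \<open>s\<close>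
  whose zeros are the poles shifted by \<open>1\<close>.
\<close>

lemma Beta_step:
  assumes "0 \<le> s"
  shows "Beta (t + a * (s + 1)) (real (Suc n)) =
    Beta (t + a * s) (real (Suc n)) * (1 - (\<Sum>i\<le>n. weight n i / (s + rate i)))"
proof -
  have p: "0 < t + a * s" "0 < t + a * (s + 1)" using t a assms by (simp_all add: add_pos_nonneg)
  have "1 - (\<Sum>i\<le>n. weight n i / (s + rate i)) = (\<Prod>i\<le>n. (s + rate i - 1) / (s + rate i))"
    unfolding weight_def
  proof (rule partial_fractions_shift[symmetric])
    show "inj_on rate {..n}" using a by (auto simp: inj_on_def rate_def)
    show "s + rate i \<noteq> 0" for i using rate_pos[of i] assms by auto
  qed simp
  also have "\<dots> = (\<Prod>i\<le>n. (t + a * s + real i) / (t + a * (s + 1) + real i))"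
  proof (intro prod.cong refl)
    fix i
    have "s + rate i - 1 = (t + a * s + real i) / a" "s + rate i = (t + a * (s + 1) + real i) / a"
      using a by (simp_all add: rate_def field_simps)
    then show "(s + rate i - 1) / (s + rate i) = (t + a * s + real i) / (t + a * (s + 1) + real i)"
      using a by simp
  qed
  also have "\<dots> = (\<Prod>i\<le>n. t + a * s + real i) / (\<Prod>i\<le>n. t + a * (s + 1) + real i)"
    by (rule prod_dividef)
  finally have ratio: "1 - (\<Sum>i\<le>n. weight n i / (s + rate i)) =
    (\<Prod>i\<le>n. t + a * s + real i) / (\<Prod>i\<le>n. t + a * (s + 1) + real i)" .
  have frac: "0 < P \<Longrightarrow> F / Q = F / P * (P / Q)" for F P Q :: real by simp
  have "0 < (\<Prod>i\<le>n. t + a * s + real i)" by (intro prod_pos) (use p in auto)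
  then show ?thesis
    unfolding Beta_Suc_real[OF p(1)] Beta_Suc_real[OF p(2)] ratio by (rule frac)
qed

lemma beta_moment_recursion:
  assumes n: "0 < n"
  shows "moment_recursion (jump_measure n) (max 0) (beta_measure n) (beta_power n)"
proof -
  have moment: "(\<integral>u. beta_power n u ^ s \<partial>beta_measure n) = real n powr t * Beta (t + a * real s) (real (Suc n))" for s
  proof -
    have "(\<integral>u. beta_power n u ^ s \<partial>beta_measure n) = (\<integral>u. beta_density n u * beta_power n u ^ s \<partial>lborel)"
      unfolding beta_measure_def by (subst integral_density) (auto simp: beta_density_nonneg)
    also have "\<dots> = real n powr t * Beta (t + a * real s) (real (Suc n))"
      by (rule has_bochner_integral_integral_eq[OF beta_power_moment[OF n]])
    finally show ?thesis .
  qed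
  have fin_K: "finite_measure (jump_measure n)"
  proof (rule finite_measureI)
    have "integrable lborel (jump_density n)"
      using integrable.intros[OF jump_Laplace[of 0 n]] by simp
    then show "emeasure (jump_measure n) (space (jump_measure n)) \<noteq> \<infinity>"
      unfolding jump_measure_def
      by (simp add: emeasure_density nn_integral_eq_integral jump_density_nonneg)
  qed
  have fin_M: "finite_measure (beta_measure n)"
  proof (rule finite_measureI)
    have "integrable lborel (beta_density n)"
      using integrable.intros[OF beta_power_moment[OF n, of 0]] by simp
    then show "emeasure (beta_measure n) (space (beta_measure n)) \<noteq> \<infinity>"
      unfolding beta_measure_def
      by (simp add: emeasure_density nn_integral_eq_integral beta_density_nonneg)
  qed
  interpret K: finite_measure "jump_measure n" by (rule fin_K)
  interpret M: finite_measure "beta_measure n" by (rule fin_M)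
  show ?thesis
  proof
    show "max 0 \<in> borel_measurable (jump_measure n)" unfolding jump_measure_def by measurable
    show "beta_power n \<in> borel_measurable (beta_measure n)" unfolding beta_measure_def by measurable
    show "0 < beta_power n u" for u by (simp add: beta_power_def)
    show "beta_power n u \<le> 1" for u using a by (simp add: beta_power_def powr_le1)
    have "0 < (\<Prod>i\<le>n. t + real i)" using t by (intro prod_pos) (auto simp: add_pos_nonneg)
    then have "0 < Beta t (real (Suc n))" unfolding Beta_Suc_real[OF t] by simp
    then show "0 < measure (beta_measure n) (space (beta_measure n))"
      using moment[of 0] n by simp
    fix s
    have "(\<integral>u. beta_power n u ^ s \<partial>beta_measure n) - (\<integral>u. beta_power n u ^ Suc s \<partial>beta_measure n) =
      (\<integral>u. beta_power n u ^ s \<partial>beta_measure n) * (\<Sum>i\<le>n. weight n i / (real s + rate i))"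
    proof -
      have step: "Beta (t + a * real (Suc s)) (real (Suc n)) =
        Beta (t + a * real s) (real (Suc n)) * (1 - (\<Sum>i\<le>n. weight n i / (real s + rate i)))"
        using Beta_step[of "real s" n] by (simp add: add.commute)
      have ring: "x * y - x * (y * (1 - z)) = x * y * z" for x y z :: real
        by (simp add: algebra_simps)
      show ?thesis unfolding moment step by (rule ring)
    qed
    then show "real s * ((\<integral>u. beta_power n u ^ s \<partial>beta_measure n) - (\<integral>u. beta_power n u ^ Suc s \<partial>beta_measure n)) =
        (\<integral>u. beta_power n u ^ s \<partial>beta_measure n) * (\<integral>y. 1 - exp (- (real s * max 0 y)) \<partial>jump_measure n)"
      by (simp only: jump_increment_integral of_nat_0_le_iff mult_ac)
  qed simp
qed

definition "beta_transform n x = (\<integral>u. beta_density n u * exp (- (x / u powr a)) \<partial>lborel)"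

text \<open>
  The Beta variable is rescaled by \<open>n\<close>, which dilates the transform by \<open>n powr a\<close>.
\<close>

lemma beta_transform_ratio_cm:
  assumes n: "0 < n" and c: "0 < c" "c < 1"
  shows "cm_upto k (\<lambda>x. beta_transform n x / beta_transform n (c * x))"
proof -
  interpret moment_recursion "jump_measure n" "max 0" "beta_measure n" "beta_power n"
    by (rule beta_moment_recursion[OF n])
  have eq: "\<phi> (1 / real n powr a * x) = beta_transform n x" for x
  proof -
    have "\<phi> (1 / real n powr a * x) = (\<integral>u. beta_density n u * exp (- (1 / real n powr a * x / beta_power n u)) \<partial>lborel)"
      unfolding \<phi>_def unfolding beta_measure_def by (subst integral_density) (auto simp: beta_density_nonneg)
    also have "\<dots> = beta_transform n x"
      unfolding beta_transform_def
    proof (intro Bochner_Integration.integral_cong refl)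
      fix u
      show "beta_density n u * exp (- (1 / real n powr a * x / beta_power n u)) = beta_density n u * exp (- (x / u powr a))"
        using n by (cases "0 < u \<and> u < real n") (auto simp: beta_density_def beta_power_def powr_divide)
    qed
    finally show ?thesis .
  qed
  have "cm_upto k (\<lambda>x. \<phi> (1 / real n powr a * x) / \<phi> (c * (1 / real n powr a * x)))"
    using n by (intro cm_upto_dilate[OF _ \<phi>_ratio_cm[OF c]]) simp
  also have "(\<lambda>x. \<phi> (1 / real n powr a * x) / \<phi> (c * (1 / real n powr a * x))) = (\<lambda>x. beta_transform n x / beta_transform n (c * x))"
    by (simp only: mult.left_commute[of c] eq)
  finally show ?thesis .
qed

lemma gamma_kernel_integrable:
  "integrable lborel (\<lambda>u. if 0 < u then u powr (t - 1) * exp (- u) else 0)"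
proof -
  have "((\<lambda>u. u powr (t - 1) / exp u) has_integral Gamma t) {0..}"
    by (rule Gamma_integral_real[OF t])
  then have "((\<lambda>u. if u \<in> {0..} then u powr (t - 1) / exp u else 0) has_integral Gamma t) UNIV"
    by (simp only: has_integral_restrict_UNIV)
  then have I: "((\<lambda>u. if 0 < u then u powr (t - 1) * exp (- u) else 0) has_integral Gamma t) UNIV"
    by (rule has_integral_eq[rotated]) (auto simp: exp_minus divide_inverse)
  have "has_bochner_integral lborel (\<lambda>u. if 0 < u then u powr (t - 1) * exp (- u) else 0) (Gamma t)"
  proof (rule has_bochner_integral_nn_integral)
    show "(\<integral>\<^sup>+u. ennreal (if 0 < u then u powr (t - 1) * exp (- u) else 0) \<partial>lborel) = ennreal (Gamma t)"
      by (rule nn_integral_has_integral_lborel[OF _ _ I]) auto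
  qed (use Gamma_real_pos[OF t] in auto)
  then show ?thesis by (rule integrable.intros)
qed

definition "gamma_transform x = (\<integral>u. (if 0 < u then u powr (t - 1) * exp (- u) else 0) * exp (- (x / u powr a)) \<partial>lborel)"

text \<open>
  Dominated convergence, with \<open>(1 - u / n) ^ n \<le> exp (- u)\<close>.
\<close>

lemma beta_transform_tendsto:
  assumes x: "0 \<le> x"
  shows "(\<lambda>n. beta_transform n x) \<longlonglongrightarrow> gamma_transform x"
  unfolding beta_transform_def gamma_transform_def
proof (rule integral_dominated_convergence[OF _ _ gamma_kernel_integrable])
  show "AE u in lborel. (\<lambda>n. beta_density n u * exp (- (x / u powr a))) \<longlonglongrightarrow>
    (if 0 < u then u powr (t - 1) * exp (- u) else 0) * exp (- (x / u powr a))"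
  proof (intro AE_I2 tendsto_mult tendsto_const)
    fix u
    show "(\<lambda>n. beta_density n u) \<longlonglongrightarrow> (if 0 < u then u powr (t - 1) * exp (- u) else 0)"
    proof (cases "0 < u")
      case True
      have "(\<lambda>n. u powr (t - 1) * (1 + (- u) / real n) ^ n) \<longlonglongrightarrow> u powr (t - 1) * exp (- u)"
        by (intro tendsto_mult tendsto_const tendsto_exp_limit_sequentially)
      moreover have "eventually (\<lambda>n. u powr (t - 1) * (1 + (- u) / real n) ^ n = beta_density n u) sequentially"
        using eventually_gt_at_top[of "nat \<lceil>u\<rceil>"]
        by eventually_elim (use True in \<open>simp add: beta_density_def, linarith\<close>)
      ultimately have "(\<lambda>n. beta_density n u) \<longlonglongrightarrow> u powr (t - 1) * exp (- u)"
        by (rule Lim_transform_eventually)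
      then show ?thesis using True by simp
    qed (simp add: beta_density_def)
  qed
  show "AE u in lborel. norm (beta_density n u * exp (- (x / u powr a))) \<le>
    (if 0 < u then u powr (t - 1) * exp (- u) else 0)" for n
  proof (rule AE_I2)
    fix u
    show "norm (beta_density n u * exp (- (x / u powr a))) \<le> (if 0 < u then u powr (t - 1) * exp (- u) else 0)"
    proof (cases "0 < u \<and> u < real n")
      case True
      have "(1 - u / real n) ^ n \<le> exp (- (u / real n)) ^ n"
        using True exp_ge_add_one_self[of "- (u / real n)"] by (intro power_mono) auto
      also have "\<dots> = exp (- u)" using True by (simp add: exp_of_nat_mult[symmetric])
      finally have "beta_density n u \<le> u powr (t - 1) * exp (- u)"
        using True by (simp add: beta_density_def mult_left_mono)
      moreover have "exp (- (x / u powr a)) \<le> 1" using x by simp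
      ultimately have "beta_density n u * exp (- (x / u powr a)) \<le> u powr (t - 1) * exp (- u) * 1"
        by (intro mult_mono) auto
      then show ?thesis using True beta_density_nonneg[of n u] by simp
    qed (simp add: beta_density_def)
  qed
qed measurable

end

theorem mainTheorem1:
  fixes M :: "'a measure" and G :: "'a \<Rightarrow> real" and t \<xi> :: real
  assumes "prob_space M"
    and "0 < t"
    and "-1 < \<xi>" and "\<xi> < 0"
    and "distributed M lborel G (\<lambda>x. ennreal (gamma_density t x))"
  shows "prob_space.self_decomposable M (\<lambda>\<omega>. G \<omega> powr \<xi>)"
proof -
  interpret prob_space M by fact
  interpret gamma_power t "- \<xi>" using assms by unfold_locales auto
  have G [measurable]: "G \<in> borel_measurable M"
    using distributed_measurable[OF assms(5)] by simp
  define L where "L x = (\<integral>\<omega>. exp (- (x * G \<omega> powr \<xi>)) \<partial>M)" for x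
  have Gamma_pos: "0 < Gamma t" using assms(2) by (rule Gamma_real_pos)
  have L_eq: "L x = gamma_transform x / Gamma t" for x
  proof -
    have "L x = (\<integral>u. gamma_density t u * exp (- (x * u powr \<xi>)) \<partial>lborel)"
      unfolding L_def
      by (rule distributed_integral[OF assms(5), symmetric]) (use Gamma_pos in \<open>auto simp: gamma_density_def\<close>)
    also have "\<dots> = (\<integral>u. (if 0 < u then u powr (t - 1) * exp (- u) else 0) * exp (- (x / u powr (- \<xi>))) / Gamma t \<partial>lborel)"
      by (intro Bochner_Integration.integral_cong refl) (auto simp: gamma_density_def powr_minus divide_inverse)
    finally show ?thesis by (simp add: gamma_transform_def)
  qed
  have L_pos: "0 < L x" if "0 \<le> x" for x
    unfolding L_def
    by (intro integral_exp_pos integrable_const_bound[of _ 1]) (use that in \<open>auto simp: prob_space\<close>)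
  have "cm_upto k (\<lambda>x. L x / L (c * x))" if c: "0 < c" "c < 1" for c k
  proof (rule cm_upto_lim)
    show "cm_upto k (\<lambda>x. beta_transform (Suc n) x / beta_transform (Suc n) (c * x))" for n
      by (rule beta_transform_ratio_cm[OF _ c]) simp
    fix x :: real assume x: "0 < x"
    have "gamma_transform (c * x) \<noteq> 0"
      using L_pos[of "c * x"] c x unfolding L_eq by auto
    then have "(\<lambda>n. beta_transform (Suc n) x / beta_transform (Suc n) (c * x)) \<longlonglongrightarrow> gamma_transform x / gamma_transform (c * x)"
      using c x by (intro tendsto_divide LIMSEQ_Suc beta_transform_tendsto) auto
    then show "(\<lambda>n. beta_transform (Suc n) x / beta_transform (Suc n) (c * x)) \<longlonglongrightarrow> L x / L (c * x)"
      using Gamma_pos by (simp add: L_eq)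
  qed
  then show ?thesis
    unfolding L_def by (intro self_decomposableI_cm) (use assms(1) in auto)
qed

end
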